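(* Let $A= k[x_1][x_2;\alpha_2,\delta_2]_p \cdots [x_n;\alpha_n,\delta_n]_p$ be an iterated Poisson polynomial algebra over a field $k$ of characteristic zero, supporting a rational action of a torus $H=(k^\times)^r$ by $k$-algebra automorphisms such that $x_1,\dots,x_n$ are $H$-eigenvectors. Let $\mathfrak h=\operatorname{Lie}H$ act on $A$ as described in the context. Assume that there exist $\eta_1,\dots,\eta_n\in\mathfrak h$ such that $\eta_i.x_j=\alpha_i(x_j)$ for all $i>j$, and such that for each $i$ the $\eta_i$-eigenvalue of $x_i$ is nonzero. Then $A$ has at most $2^n$ $H$-stable Poisson prime ideals.
   Context: A Poisson algebra is a commutative $k$-algebra with a Lie bracket $\{-,-\}$ that is a derivation in each variable. A Poisson ideal is an ideal $I$ with $\{A,I\}\subseteq I$; a Poisson prime ideal is a prime ideal that is a Poisson ideal. If $B$ is a Poisson algebra, $\alpha$ is a Poisson derivation of $B$ (a derivation for both the product and the bracket) and $\delta$ is a derivation of $B$ with $\delta(\{a,b\})=\{\delta(a),b\}+\{a,\delta(b)\}+\alpha(a)\delta(b)-\delta(a)\alpha(b)$ for all $a,b\in B$, then $B[x;\alpha,\delta]_p$ denotes the polynomial ring $B[x]$ with the unique Poisson bracket extending that of $B$ and satisfying $\{x,b\}=\alpha(b)x+\delta(b)$ for $b\in B$. An iterated Poisson polynomial algebra $k[x_1][x_2;\alpha_2,\delta_2]_p\cdots[x_n;\alpha_n,\delta_n]_p$ is built by iterating this construction starting from $k[x_1]$ with zero bracket. An action of $H=(k^\times)^r$ on $A$ by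 $k$-algebra automorphisms is rational if $A$ is the direct sum of its $H$-eigenspaces $A_x$, $x\in X(H)$, where the characters are identified with $\mathbb Z^r$ via $(m_1,\dots,m_r)\mapsto (h\mapsto h_1^{m_1}\cdots h_r^{m_r})$. The Lie algebra $\mathfrak h=\operatorname{Lie}H$ is identified with $k^r$ and acts on $A$ (the differential of the $H$-action) by $\eta.a=(\eta|x)a$ for $a\in A_x$, where $(-|-)$ is the standard dot product on $k^r$. An $\eta$-eigenvalue of an $H$-eigenvector $a\in A_x$ is the scalar $(\eta|x)$. *)

theory Defs
  imports Main
begin

definition is_ideal :: "'a::comm_ring_1 set \<Rightarrow> bool" where
  "is_ideal I \<longleftrightarrow> 0 \<in> I \<and> (\<forall>a\<in>I. \<forall>b\<in>I. a + b \<in> I) \<and> (\<forall>a. \<forall>b\<in>I. a * b \<in> I)"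

definition is_prime_ideal :: "'a::comm_ring_1 set \<Rightarrow> bool" where
  "is_prime_ideal I \<longleftrightarrow> is_ideal I \<and> 1 \<notin> I \<and> (\<forall>a b. a * b \<in> I \<longrightarrow> a \<in> I \<or> b \<in> I)"

definition is_poisson_ideal :: "('a::comm_ring_1 \<Rightarrow> 'a \<Rightarrow> 'a) \<Rightarrow> 'a set \<Rightarrow> bool" where
  "is_poisson_ideal br I \<longleftrightarrow> is_ideal I \<and> (\<forall>a. \<forall>b\<in>I. br a b \<in> I)"

definition is_poisson_prime :: "('a::comm_ring_1 \<Rightarrow> 'a \<Rightarrow> 'a) \<Rightarrow> 'a set \<Rightarrow> bool" where
  "is_poisson_prime br I \<longleftrightarrow> is_prime_ideal I \<and> is_poisson_ideal br I"

definition k_algebra :: "('k::field \<Rightarrow> 'a::comm_ring_1) \<Rightarrow> bool" where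
  "k_algebra sc \<longleftrightarrow> sc 0 = 0 \<and> sc 1 = 1 \<and> (\<forall>c d. sc (c + d) = sc c + sc d) \<and> (\<forall>c d. sc (c * d) = sc c * sc d)"

definition monom :: "(nat \<Rightarrow> 'a::comm_ring_1) \<Rightarrow> nat \<Rightarrow> (nat \<Rightarrow> nat) \<Rightarrow> 'a" where
  "monom x j m = (\<Prod>i<j. x i ^ m i)"

definition kspan :: "('k::field \<Rightarrow> 'a::comm_ring_1) \<Rightarrow> (nat \<Rightarrow> 'a) \<Rightarrow> nat \<Rightarrow> 'a set" where
  "kspan sc x j = {a. \<exists>M c. finite M \<and> (\<forall>m\<in>M. \<forall>i. j \<le> i \<longrightarrow> m i = 0) \<and>
                        a = (\<Sum>m\<in>M. sc (c m) * monom x j m)}"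

definition poly_alg :: "('k::field \<Rightarrow> 'a::comm_ring_1) \<Rightarrow> (nat \<Rightarrow> 'a) \<Rightarrow> nat \<Rightarrow> bool" where
  "poly_alg sc x n \<longleftrightarrow> k_algebra sc \<and> kspan sc x n = UNIV \<and>
     (\<forall>M c. finite M \<and> (\<forall>m\<in>M. \<forall>i. n \<le> i \<longrightarrow> m i = 0) \<and> (\<Sum>m\<in>M. sc (c m) * monom x n m) = 0
        \<longrightarrow> (\<forall>m\<in>M. c m = 0))"

definition k_linear_on :: "('k::field \<Rightarrow> 'a::comm_ring_1) \<Rightarrow> 'a set \<Rightarrow> ('a \<Rightarrow> 'a) \<Rightarrow> bool" where
  "k_linear_on sc S f \<longleftrightarrow> (\<forall>a\<in>S. \<forall>b\<in>S. f (a + b) = f a + f b) \<and> (\<forall>c. \<forall>a\<in>S. f (sc c * a) = sc c * f a)"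

definition derivation_on :: "('k::field \<Rightarrow> 'a::comm_ring_1) \<Rightarrow> 'a set \<Rightarrow> ('a \<Rightarrow> 'a) \<Rightarrow> bool" where
  "derivation_on sc S f \<longleftrightarrow> k_linear_on sc S f \<and> (\<forall>a\<in>S. \<forall>b\<in>S. f (a * b) = f a * b + a * f b)"

definition poisson_bracket :: "('k::field \<Rightarrow> 'a::comm_ring_1) \<Rightarrow> ('a \<Rightarrow> 'a \<Rightarrow> 'a) \<Rightarrow> bool" where
  "poisson_bracket sc br \<longleftrightarrow>
     (\<forall>a. k_linear_on sc UNIV (br a)) \<and> (\<forall>b. k_linear_on sc UNIV (\<lambda>a. br a b)) \<and>
     (\<forall>a. br a a = 0) \<and> (\<forall>a b. br a b = - br b a) \<and>
     (\<forall>a b c. br a (br b c) + br b (br c a) + br c (br a b) = 0) \<and>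
     (\<forall>a b c. br a (b * c) = br a b * c + b * br a c) \<and>
     (\<forall>a b c. br (a * b) c = br a c * b + a * br b c)"

definition poisson_derivation_on :: "('k::field \<Rightarrow> 'a::comm_ring_1) \<Rightarrow> ('a \<Rightarrow> 'a \<Rightarrow> 'a) \<Rightarrow> 'a set \<Rightarrow> ('a \<Rightarrow> 'a) \<Rightarrow> bool" where
  "poisson_derivation_on sc br S f \<longleftrightarrow> derivation_on sc S f \<and>
     (\<forall>a\<in>S. \<forall>b\<in>S. f (br a b) = br (f a) b + br a (f b))"

(* A = k[x_0][x_1; al_1, de_1]_p ... [x_{n-1}; al_{n-1}, de_{n-1}]_p  (0-based indexing) *)
definition iterated_poisson :: "('k::field \<Rightarrow> 'a::comm_ring_1) \<Rightarrow> ('a \<Rightarrow> 'a \<Rightarrow> 'a) \<Rightarrow> (nat \<Rightarrow> 'a) \<Rightarrow> nat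
      \<Rightarrow> (nat \<Rightarrow> 'a \<Rightarrow> 'a) \<Rightarrow> (nat \<Rightarrow> 'a \<Rightarrow> 'a) \<Rightarrow> bool" where
  "iterated_poisson sc br x n al de \<longleftrightarrow> poly_alg sc x n \<and> poisson_bracket sc br \<and>
     (\<forall>i. 1 \<le> i \<and> i < n \<longrightarrow>
        al i ` kspan sc x i \<subseteq> kspan sc x i \<and> de i ` kspan sc x i \<subseteq> kspan sc x i \<and>
        poisson_derivation_on sc br (kspan sc x i) (al i) \<and>
        derivation_on sc (kspan sc x i) (de i) \<and>
        (\<forall>a\<in>kspan sc x i. \<forall>b\<in>kspan sc x i.
            de i (br a b) = br (de i a) b + br a (de i b) + al i a * de i b - de i a * al i b) \<and>
        (\<forall>b\<in>kspan sc x i. br (x i) b = al i b * x i + de i b))"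

definition torus :: "nat \<Rightarrow> (nat \<Rightarrow> 'k::field) set" where
  "torus r = {h. (\<forall>i<r. h i \<noteq> 0) \<and> (\<forall>i. r \<le> i \<longrightarrow> h i = 1)}"

definition char_val :: "nat \<Rightarrow> (nat \<Rightarrow> 'k::field) \<Rightarrow> (nat \<Rightarrow> int) \<Rightarrow> 'k" where
  "char_val r h chi = (\<Prod>i<r. h i powi chi i)"

definition eigsp :: "('k::field \<Rightarrow> 'a::comm_ring_1) \<Rightarrow> ((nat \<Rightarrow> 'k) \<Rightarrow> 'a \<Rightarrow> 'a) \<Rightarrow> nat \<Rightarrow> (nat \<Rightarrow> int) \<Rightarrow> 'a set" where
  "eigsp sc act r chi = {a. \<forall>h\<in>torus r. act h a = sc (char_val r h chi) * a}"

definition rational_torus_action :: "('k::field \<Rightarrow> 'a::comm_ring_1) \<Rightarrow> ((nat \<Rightarrow> 'k) \<Rightarrow> 'a \<Rightarrow> 'a) \<Rightarrow> nat \<Rightarrow> bool" where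
  "rational_torus_action sc act r \<longleftrightarrow>
     (\<forall>h\<in>torus r. bij (act h) \<and> (\<forall>a b. act h (a + b) = act h a + act h b) \<and>
                   (\<forall>a b. act h (a * b) = act h a * act h b) \<and> (\<forall>c. act h (sc c) = sc c)) \<and>
     (\<forall>a. act (\<lambda>i. 1) a = a) \<and>
     (\<forall>h\<in>torus r. \<forall>g\<in>torus r. \<forall>a. act (\<lambda>i. h i * g i) a = act h (act g a)) \<and>
     (\<forall>a. \<exists>S f. finite S \<and> (\<forall>chi\<in>S. f chi \<in> eigsp sc act r chi) \<and> a = sum f S)"

definition dotp :: "nat \<Rightarrow> (nat \<Rightarrow> 'k::field) \<Rightarrow> (nat \<Rightarrow> int) \<Rightarrow> 'k" where
  "dotp r eta chi = (\<Sum>i<r. eta i * of_int (chi i))"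

definition H_stable :: "((nat \<Rightarrow> 'k::field) \<Rightarrow> 'a \<Rightarrow> 'a) \<Rightarrow> nat \<Rightarrow> 'a set \<Rightarrow> bool" where
  "H_stable act r I \<longleftrightarrow> (\<forall>h\<in>torus r. act h ` I = I)"

end

theory Submission
  imports Defs
begin

text \<open>
  Let \<open>B[x]\<close> be one step of the tower, and let \<open>P\<close> be an \<open>H\<close>-stable Poisson prime of \<open>B[x]\<close> with
  contraction \<open>Q = P \<inter> B\<close>. At most two such \<open>P\<close> lie over \<open>Q\<close>, so each step at most doubles the
  number of primes. Suppose \<open>P \<noteq> Q[x]\<close> and let \<open>f = b x\<^sup>m + c x\<^bsup>m-1\<^esup> + \<dots>\<close> be a
  homogeneous element of \<open>P\<close> of least degree with \<open>b \<notin> Q\<close>. Comparing coefficients of the brackets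
  of \<open>f\<close> with elements of \<open>B\<close> shows that \<open>y = x + c / (m b)\<close> satisfies \<open>{y, a} = \<alpha>(a) y\<close> for \<open>a\<close> in
  the fraction field of \<open>B/Q\<close>. Then \<open>y\<^sup>2 \<partial>f/\<partial>x\<close> lies in \<open>P\<close>, which forces \<open>y \<in> P\<close>. Two such
  \<open>y, y'\<close> differ by a homogeneous \<open>e\<close> of the weight of \<open>x\<close> with \<open>{e, a} = \<alpha>(a) e\<close>; for \<open>a = e\<close> this
  gives \<open>s e\<^sup>2 = 0\<close> with \<open>s \<noteq> 0\<close> the eigenvalue of \<open>x\<close>, so \<open>y\<close>, and hence \<open>P\<close>, is unique.
\<close>

section \<open>Primes of a Poisson polynomial extension\<close>

text \<open>The image of the polynomial ring over \<open>B\<close> under evaluation at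
  \<open>y\<close>, kept as a subset of the ambient type. Values of \<open>b\<close> beyond
  \<open>d\<close> need only lie in \<open>B\<close>, so sums of different length are truncated to
  zero before they are merged.\<close>

definition adjoin :: "'a::comm_ring_1 set \<Rightarrow> 'a \<Rightarrow> 'a set" where
  "adjoin B y = {a. \<exists>d b. (\<forall>i. b i \<in> B) \<and> a = (\<Sum>i\<le>d. b i * y ^ i)}"

text \<open>Relativised to a subset \<open>S\<close> because all rings of the tower live in one
  type; for \<open>S = UNIV\<close> this is \<open>is_poisson_prime\<close>.\<close>

definition poisson_prime_in :: "('a::comm_ring_1 \<Rightarrow> 'a \<Rightarrow> 'a) \<Rightarrow> 'a set \<Rightarrow> 'a set \<Rightarrow> bool" where
  "poisson_prime_in br S P \<longleftrightarrow> P \<subseteq> S \<and> 0 \<in> P \<and> (\<forall>a\<in>P. \<forall>b\<in>P. a + b \<in> P) \<and> (\<forall>a\<in>S. \<forall>b\<in>P. a * b \<in> P) \<and>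
     1 \<notin> P \<and> (\<forall>a\<in>S. \<forall>b\<in>S. a * b \<in> P \<longrightarrow> a \<in> P \<or> b \<in> P) \<and> (\<forall>a\<in>S. \<forall>b\<in>P. br a b \<in> P)"

section \<open>Bracket calculus in a Poisson algebra\<close>

locale poisson_alg =
  fixes sc :: "'k::field_char_0 \<Rightarrow> 'a::comm_ring_1" and br :: "'a \<Rightarrow> 'a \<Rightarrow> 'a"
  assumes alg: "k_algebra sc" and poisson: "poisson_bracket sc br"
begin

lemma sc_0: "sc 0 = 0" and sc_1: "sc 1 = 1"
  and sc_add: "sc (c + d) = sc c + sc d" and sc_mult: "sc (c * d) = sc c * sc d"
  using alg by (auto simp: k_algebra_def)

lemma sc_minus: "sc (- c) = - sc c"
  using sc_add[of "- c" c] by (simp add: sc_0 eq_neg_iff_add_eq_0)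

lemma sc_diff: "sc (c - d) = sc c - sc d"
  using sc_add[of c "- d"] by (simp add: sc_minus)

lemma sc_of_nat: "sc (of_nat m) = of_nat m"
  by (induction m) (simp_all add: sc_0 sc_1 sc_add)

lemma sc_cancel: "c \<noteq> 0 \<Longrightarrow> sc (inverse c) * (sc c * a) = a"
  by (simp add: mult.assoc[symmetric] sc_mult[symmetric] sc_1)

lemma
  shows br_linear_right: "k_linear_on sc UNIV (br a)"
    and br_linear_left: "k_linear_on sc UNIV (\<lambda>u. br u b)"
    and br_self: "br a a = 0"
    and br_anti: "br a b = - br b a"
    and br_mult_right: "br a (b * c) = br a b * c + b * br a c"
    and br_mult_left: "br (a * b) c = br a c * b + a * br b c"
  using poisson unfolding poisson_bracket_def by (elim conjE; metis)+

lemma br_add_left: "br (a + b) c = br a c + br b c"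
  using br_linear_left[of c] by (simp add: k_linear_on_def)

lemma br_add_right: "br a (b + c) = br a b + br a c"
  and br_sc_mult: "br a (sc k * b) = sc k * br a b"
  using br_linear_right[of a] by (simp_all add: k_linear_on_def)

lemma br_0_right: "br a 0 = 0"
  using br_add_right[of a 0 0] by simp

lemma br_0_left: "br 0 a = 0"
  using br_add_left[of 0 0 a] by simp

lemma br_sc_right: "br a (sc k) = 0"
  using br_mult_right[of a 1 1] br_sc_mult[of a k 1] by simp

lemma br_sc_left: "br (sc k) a = 0"
  using br_anti[of "sc k" a] by (simp add: br_sc_right)

lemma br_diff_left: "br (a - b) c = br a c - br b c"
  using br_add_left[of "a - b" b c] by simp

lemma br_sum_left: "br (\<Sum>i\<in>I. f i) c = (\<Sum>i\<in>I. br (f i) c)"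
  by (induction I rule: infinite_finite_induct) (simp_all add: br_0_left br_add_left)

lemma br_sum_right: "br c (\<Sum>i\<in>I. f i) = (\<Sum>i\<in>I. br c (f i))"
  by (induction I rule: infinite_finite_induct) (simp_all add: br_0_right br_add_right)

text \<open>Iterated Leibniz rule. The truncated exponent at \<open>i = 0\<close> is harmless
  because the factor \<open>of_nat i\<close> vanishes there.\<close>

lemma br_power_right: "br a (y ^ i) = of_nat i * y ^ (i - 1) * br a y"
proof (induction i)
  case 0
  show ?case using br_sc_right[of a 1] by (simp add: sc_1)
next
  case (Suc i)
  have "br a (y ^ Suc i) = br a y * y ^ i + of_nat i * (y * y ^ (i - 1)) * br a y"
    by (simp add: br_mult_right Suc mult_ac)
  also have "of_nat i * (y * y ^ (i - 1)) = of_nat i * y ^ i"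
    by (cases i) simp_all
  finally show ?case by (simp add: algebra_simps)
qed

lemma br_power_left: "br (y ^ i) a = of_nat i * y ^ (i - 1) * br y a"
  using br_power_right[of a y i] br_anti[of "y ^ i" a] br_anti[of y a] by simp

end

text \<open>One step of the tower. The scalar \<open>s\<close> stands for the eigenvalue of
  \<open>x\<close>; it enters through homogeneous elements, whose coefficients have
  \<open>al\<close>-eigenvalues dropping by \<open>s\<close> with each power of
  \<open>x\<close>.\<close>

locale poisson_ext = poisson_alg sc br
  for sc :: "'k::field_char_0 \<Rightarrow> 'a::comm_ring_1" and br :: "'a \<Rightarrow> 'a \<Rightarrow> 'a" +
  fixes B :: "'a set" and x :: 'a and al de :: "'a \<Rightarrow> 'a" and s :: 'k
  assumes sc_B: "sc c \<in> B"
    and add_B: "a \<in> B \<Longrightarrow> b \<in> B \<Longrightarrow> a + b \<in> B"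
    and mult_B: "a \<in> B \<Longrightarrow> b \<in> B \<Longrightarrow> a * b \<in> B"
    and br_B: "a \<in> B \<Longrightarrow> b \<in> B \<Longrightarrow> br a b \<in> B"
    and al_B: "a \<in> B \<Longrightarrow> al a \<in> B"
    and de_B: "a \<in> B \<Longrightarrow> de a \<in> B"
    and al_add: "a \<in> B \<Longrightarrow> b \<in> B \<Longrightarrow> al (a + b) = al a + al b"
    and al_mult: "a \<in> B \<Longrightarrow> b \<in> B \<Longrightarrow> al (a * b) = al a * b + a * al b"
    and br_x: "a \<in> B \<Longrightarrow> br x a = al a * x + de a"
    and s_nz: "s \<noteq> 0"
begin

abbreviation "S \<equiv> adjoin B x"

section \<open>Closure properties of \<open>B\<close> and of the extension \<open>S\<close>\<close>

lemma zero_B: "0 \<in> B" and one_B: "1 \<in> B" and of_nat_B: "of_nat m \<in> B"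
  using sc_B[of 0] sc_B[of 1] sc_B[of "of_nat m"] by (simp_all add: sc_0 sc_1 sc_of_nat)

lemma minus_B: "a \<in> B \<Longrightarrow> - a \<in> B"
  using mult_B[OF sc_B[of "- 1"], of a] by (simp add: sc_minus sc_1)

lemma diff_B: "a \<in> B \<Longrightarrow> b \<in> B \<Longrightarrow> a - b \<in> B"
  using add_B[of a "- b"] minus_B[of b] by simp

lemma al_diff: "a \<in> B \<Longrightarrow> b \<in> B \<Longrightarrow> al (a - b) = al a - al b"
  using al_add[of "a - b" b] diff_B[of a b] by simp

lemma adjoin_term: "b \<in> B \<Longrightarrow> b * x ^ i \<in> S"
  unfolding adjoin_def
  by (intro CollectI exI[of _ i] exI[of _ "\<lambda>k. if k = i then b else 0"])
    (auto simp: zero_B if_distrib[of "\<lambda>u. u * _"] cong: if_cong)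

lemma B_sub_S: "b \<in> B \<Longrightarrow> b \<in> S" and x_S: "x \<in> S"
  using adjoin_term[of b 0] adjoin_term[OF one_B, of 1] by simp_all

lemma add_S:
  assumes "a \<in> S" "b \<in> S"
  shows "a + b \<in> S"
proof -
  obtain d f where f: "\<And>i. f i \<in> B" "a = (\<Sum>i\<le>d. f i * x ^ i)"
    using assms(1) unfolding adjoin_def by blast
  obtain e g where g: "\<And>i. g i \<in> B" "b = (\<Sum>i\<le>e. g i * x ^ i)"
    using assms(2) unfolding adjoin_def by blast
  let ?f = "\<lambda>i. if i \<le> d then f i else 0" and ?g = "\<lambda>i. if i \<le> e then g i else 0"
  have "a = (\<Sum>i\<le>max d e. ?f i * x ^ i)" "b = (\<Sum>i\<le>max d e. ?g i * x ^ i)"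
    unfolding f(2) g(2) by (intro sum.mono_neutral_cong_left; auto)+
  then have "a + b = (\<Sum>i\<le>max d e. (?f i + ?g i) * x ^ i)"
    by (simp only: sum.distrib distrib_right)
  moreover have "\<forall>i. ?f i + ?g i \<in> B"
    using f(1) g(1) zero_B add_B by auto
  ultimately show ?thesis
    unfolding adjoin_def by (intro CollectI exI[of _ "max d e"] exI[of _ "\<lambda>i. ?f i + ?g i"]) simp
qed

lemma sum_S: "(\<And>i. i \<in> I \<Longrightarrow> f i \<in> S) \<Longrightarrow> (\<Sum>i\<in>I. f i) \<in> S"
  by (induction I rule: infinite_finite_induct) (auto simp: B_sub_S zero_B add_S)

text \<open>\<open>S\<close> is generated by \<open>B\<close> and \<open>x\<close> under sums and
  products, so closure properties can be checked on generators instead of on coefficients.\<close>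

lemma S_induct [consumes 1, case_names B x add mult]:
  assumes "a \<in> S" and "\<And>b. b \<in> B \<Longrightarrow> Q b" and "Q x"
    and "\<And>a b. a \<in> S \<Longrightarrow> b \<in> S \<Longrightarrow> Q a \<Longrightarrow> Q b \<Longrightarrow> Q (a + b)"
    and "\<And>a b. a \<in> S \<Longrightarrow> b \<in> S \<Longrightarrow> Q a \<Longrightarrow> Q b \<Longrightarrow> Q (a * b)"
  shows "Q a"
proof -
  have pow: "x ^ i \<in> S \<and> Q (x ^ i)" for i
  proof (induction i)
    case 0
    then show ?case using assms(2)[OF one_B] B_sub_S[OF one_B] by simp
  next
    case (Suc i)
    then show ?case using adjoin_term[OF one_B, of "Suc i"] assms(5)[OF x_S _ assms(3)] by simp
  qed
  have trm: "Q (b * x ^ i)" if "b \<in> B" for b i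
    using assms(5)[OF B_sub_S[OF that] _ assms(2)[OF that]] pow by blast
  have sm: "(\<Sum>i\<in>I. f i * x ^ i) \<in> S \<and> Q (\<Sum>i\<in>I. f i * x ^ i)" if "\<forall>i. f i \<in> B" for f and I :: "nat set"
    by (induction I rule: infinite_finite_induct)
      (auto simp: that B_sub_S zero_B assms(2) trm intro!: add_S assms(4) adjoin_term)
  show ?thesis using assms(1) sm unfolding adjoin_def by blast
qed

lemma mult_S:
  assumes "a \<in> S" "b \<in> S"
  shows "a * b \<in> S"
proof -
  obtain d f where f: "\<And>i. f i \<in> B" "a = (\<Sum>i\<le>d. f i * x ^ i)"
    using assms(1) unfolding adjoin_def by blast
  obtain e g where g: "\<And>i. g i \<in> B" "b = (\<Sum>i\<le>e. g i * x ^ i)"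
    using assms(2) unfolding adjoin_def by blast
  have "a * b = (\<Sum>i\<le>d. \<Sum>k\<le>e. (f i * g k) * x ^ (i + k))"
    unfolding f(2) g(2) sum_product by (simp add: power_add mult_ac)
  then show ?thesis
    by (simp add: sum_S adjoin_term mult_B f(1) g(1))
qed

lemma power_S: "a \<in> S \<Longrightarrow> a ^ i \<in> S"
  by (induction i) (simp_all add: B_sub_S one_B mult_S)

lemma minus_S: "a \<in> S \<Longrightarrow> - a \<in> S"
  using mult_S[OF B_sub_S[OF minus_B[OF one_B]], of a] by simp

lemma diff_S: "a \<in> S \<Longrightarrow> b \<in> S \<Longrightarrow> a - b \<in> S"
  using add_S[of a "- b"] minus_S[of b] by simp

lemma br_x_S: "b \<in> B \<Longrightarrow> br x b \<in> S"
  by (simp add: br_x add_S mult_S B_sub_S x_S al_B de_B)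

lemma br_S_right:
  assumes "c \<in> S" "\<And>b. b \<in> B \<Longrightarrow> br a b \<in> S" "br a x \<in> S"
  shows "br a c \<in> S"
  using assms(1)
  by (induction rule: S_induct) (auto simp: assms br_add_right br_mult_right add_S mult_S)

lemma br_S: assumes "a \<in> S" "c \<in> S" shows "br a c \<in> S"
proof -
  have 1: "br b c \<in> S" if "b \<in> B" for b
    by (rule br_S_right[OF assms(2)])
      (auto simp: that br_B B_sub_S br_anti[of b x] br_x_S minus_S)
  have 2: "br x c \<in> S"
    by (rule br_S_right[OF assms(2)]) (auto simp: br_x_S br_self B_sub_S zero_B)
  from assms(1) show ?thesis
    by (induction rule: S_induct) (auto simp: 1 2 br_add_left br_mult_left add_S mult_S)
qed

end


section \<open>Prime ideals of one extension and their leading coefficients\<close>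

locale poisson_ext_prime = poisson_ext sc br B x al de s
  for sc :: "'k::field_char_0 \<Rightarrow> 'a::comm_ring_1" and br :: "'a \<Rightarrow> 'a \<Rightarrow> 'a"
    and B x al de s +
  fixes P :: "'a set"
  assumes prime_P: "poisson_prime_in br S P"
begin

lemma P_S: "a \<in> P \<Longrightarrow> a \<in> S"
  and zero_P: "0 \<in> P" and one_P: "1 \<notin> P"
  and add_P: "a \<in> P \<Longrightarrow> b \<in> P \<Longrightarrow> a + b \<in> P"
  and mult_P: "a \<in> S \<Longrightarrow> b \<in> P \<Longrightarrow> a * b \<in> P"
  and br_P: "a \<in> S \<Longrightarrow> b \<in> P \<Longrightarrow> br a b \<in> P"
  using prime_P by (simp_all add: poisson_prime_in_def subset_iff)

lemma cancel_P: "a \<in> S \<Longrightarrow> a \<notin> P \<Longrightarrow> b \<in> S \<Longrightarrow> a * b \<in> P \<Longrightarrow> b \<in> P"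
  using prime_P unfolding poisson_prime_in_def by metis

lemma mult_P': "b \<in> P \<Longrightarrow> a \<in> S \<Longrightarrow> b * a \<in> P"
  using mult_P[of a b] by (simp add: mult.commute)

lemma minus_P: "a \<in> P \<Longrightarrow> - a \<in> P"
  using mult_P[OF minus_S[OF B_sub_S[OF one_B]], of a] by simp

lemma diff_P: "a \<in> P \<Longrightarrow> b \<in> P \<Longrightarrow> a - b \<in> P"
  using add_P[of a "- b"] minus_P[of b] by simp

lemma sum_P: "(\<And>i. i \<in> I \<Longrightarrow> f i \<in> P) \<Longrightarrow> (\<Sum>i\<in>I. f i) \<in> P"
  by (induction I rule: infinite_finite_induct) (auto simp: zero_P add_P)

lemma sc_cancel_P: "c \<noteq> 0 \<Longrightarrow> sc c * a \<in> P \<Longrightarrow> a \<in> P"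
  using mult_P[OF B_sub_S[OF sc_B], of "sc c * a" "inverse c"] by (simp add: sc_cancel)

lemma of_nat_cancel_P: "0 < m \<Longrightarrow> of_nat m * a \<in> P \<Longrightarrow> a \<in> P"
  using sc_cancel_P[of "of_nat m" a] by (simp add: sc_of_nat)

text \<open>As \<open>b d\<close> lies in \<open>B\<close>, the last condition says that the leading
  coefficient survives modulo the contraction \<open>P \<inter> B\<close>.\<close>

definition has_lead :: "nat \<Rightarrow> bool" where
  "has_lead d \<longleftrightarrow> (\<exists>b. (\<forall>i. b i \<in> B) \<and> (\<Sum>i\<le>d. b i * x ^ i) \<in> P \<and> b d \<notin> P)"

text \<open>The top coefficient lies in \<open>P\<close>, since otherwise \<open>has_lead\<close>
  would hold in its degree; removing its term leaves a shorter sum.\<close>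

lemma coeffs_P:
  assumes "\<And>d. d < m \<Longrightarrow> \<not> has_lead d" "\<And>i. g i \<in> B" "(\<Sum>i<m. g i * x ^ i) \<in> P" "i < m"
  shows "g i \<in> P"
  using assms
proof (induction m)
  case (Suc m)
  have m: "g m \<in> P"
    using Suc.prems(1)[of m] Suc.prems(2,3) unfolding has_lead_def lessThan_Suc_atMost by blast
  have "(\<Sum>i<m. g i * x ^ i) = (\<Sum>i<Suc m. g i * x ^ i) - g m * x ^ m"
    by simp
  also have "\<dots> \<in> P"
    using Suc.prems(3) m by (intro diff_P mult_P' power_S x_S)
  finally show ?case
    using Suc m by (cases "i = m") auto
qed simp

text \<open>With \<open>y = x + c / u\<close>, the expression is \<open>u * u\<close> times {y, a} -
  \<alpha>(a) y. The combination of {a, z} and z used here eliminates \<open>x\<close>, so the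
  relation lives in \<open>B\<close> and depends on the contraction of \<open>P\<close>
  alone.\<close>

lemma linear_bracket:
  assumes B: "u \<in> B" "c \<in> B" "a \<in> B" and z: "u * x + c \<in> P"
  shows "u * br c a - c * br u a - u * c * al a + u * u * de a \<in> P"
proof -
  have "u * br a (u * x + c) \<in> P"
    by (intro mult_P br_P z B_sub_S B)
  moreover have "(br u a + u * al a) * (u * x + c) \<in> P"
    by (intro mult_P add_S mult_S z B_sub_S B br_B al_B)
  ultimately have "- (u * br a (u * x + c)) - (br u a + u * al a) * (u * x + c) \<in> P"
    by (intro diff_P minus_P)
  also have "br a (u * x + c) = - (br u a * x + u * (al a * x + de a) + br c a)"
    using br_anti[of a "u * x + c"] br_x[OF B(3)] by (simp add: br_add_left br_mult_left)
  finally show ?thesis by (simp add: algebra_simps)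
qed

text \<open>Serves to compare two primes with the same contraction: \<open>K'\<close> speaks of
  elements of \<open>B\<close> only, yet it forces the second linear element into \<open>P\<close>.
  The difference of the two candidates for \<open>y\<close> has eigenvalue \<open>s\<close>, which
  makes its square vanish modulo \<open>P\<close>.\<close>

lemma linear_unique:
  assumes B: "u \<in> B" "c \<in> B" "u' \<in> B" "c' \<in> B"
    and u: "u \<notin> P" "u' \<notin> P"
    and al: "al u = sc \<beta> * u" "al c = sc (\<beta> + s) * c"
      "al u' = sc \<beta>' * u'" "al c' = sc (\<beta>' + s) * c'"
    and z: "u * x + c \<in> P"
    and K: "\<And>a. a \<in> B \<Longrightarrow> u * br c a - c * br u a - u * c * al a + u * u * de a \<in> P"
    and K': "\<And>a. a \<in> B \<Longrightarrow> u' * br c' a - c' * br u' a - u' * c' * al a + u' * u' * de a \<in> P"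
  shows "u' * x + c' \<in> P"
proof -
  define v where "v = u * u'"
  \<comment> \<open>\<open>e / v = c' / u' - c / u\<close> is the difference of the two candidates
    for \<open>y\<close>.\<close>
  define e where "e = u * c' - u' * c"
  have vB: "v \<in> B" and eB: "e \<in> B"
    unfolding v_def e_def by (intro diff_B mult_B B)+
  have vP: "v \<notin> P"
    unfolding v_def using cancel_P[of u u'] u B B_sub_S by blast
  \<comment> \<open>Over a common denominator the two relations subtract so that \<open>de\<close>
    cancels; what remains is \<open>v * v\<close> times {e/v, a} - \<alpha>(a) e/v.\<close>
  have L: "v * br e a - e * (br v a + v * al a) \<in> P" if a: "a \<in> B" for a
  proof -
    have "u * u * (u' * br c' a - c' * br u' a - u' * c' * al a + u' * u' * de a)
        - u' * u' * (u * br c a - c * br u a - u * c * al a + u * u * de a) \<in> P" (is "?w \<in> P")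
      by (intro diff_P mult_P K K' a mult_S B_sub_S B)
    also have "?w = v * br e a - e * (br v a + v * al a)"
      unfolding v_def e_def br_diff_left br_mult_left by (simp add: algebra_simps)
    finally show ?thesis .
  qed
  have alv: "al v = sc (\<beta> + \<beta>') * v"
    unfolding v_def by (simp add: al_mult B al sc_add algebra_simps)
  have ale: "al e = sc (\<beta> + \<beta>' + s) * e"
    unfolding e_def by (simp add: al_diff mult_B al_mult B al sc_add algebra_simps)
  \<comment> \<open>The case \<open>a = v\<close> determines {e, v} modulo \<open>P\<close>. In the
    case \<open>a = e\<close> below, this value cancels {v, e} and leaves only the term with
    \<open>s\<close>.\<close>
  have "v * (br e v - sc (\<beta> + \<beta>') * e * v) \<in> P"
    using L[OF vB] by (simp add: br_self alv algebra_simps)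
  then have "br e v - sc (\<beta> + \<beta>') * e * v \<in> P"
    using vP by (elim cancel_P[rotated -1]) (auto intro!: B_sub_S vB diff_B br_B mult_B sc_B eB)
  then have "(v * br e e - e * (br v e + v * al e)) - e * (br e v - sc (\<beta> + \<beta>') * e * v) \<in> P"
    by (intro diff_P[OF L[OF eB]] mult_P B_sub_S eB)
  also have "(v * br e e - e * (br v e + v * al e)) - e * (br e v - sc (\<beta> + \<beta>') * e * v)
      = sc (- s) * (v * (e * e))"
    by (simp add: br_self br_anti[of v e] ale sc_add sc_minus algebra_simps)
  finally have "v * (e * e) \<in> P"
    using s_nz sc_cancel_P[of "- s"] by simp
  then have "e \<in> P"
    using cancel_P vP B_sub_S[OF vB] B_sub_S[OF eB] mult_S by blast
  then have "u' * (u * x + c) + e \<in> P"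
    by (intro add_P mult_P z B_sub_S B)
  also have "u' * (u * x + c) + e = u * (u' * x + c')"
    by (simp add: e_def algebra_simps)
  finally have "u * (u' * x + c') \<in> P" .
  then show ?thesis
    by (rule cancel_P[OF B_sub_S[OF B(1)] u(1), rotated]) (intro x_S add_S mult_S B_sub_S B)
qed

section \<open>Brackets with an element of least degree\<close>

lemma br_poly:
  assumes "a \<in> B"
  shows "br (\<Sum>i\<le>Suc k. b i * x ^ i) a =
    (\<Sum>i\<le>k. (br (b i) a + of_nat i * b i * al a + of_nat (Suc i) * b (Suc i) * de a) * x ^ i)
    + (br (b (Suc k)) a + of_nat (Suc k) * b (Suc k) * al a) * x ^ Suc k"
proof -
  define F where "F i = (br (b i) a + of_nat i * b i * al a) * x ^ i" for i
  define G where "G i = of_nat i * b i * de a * x ^ (i - 1)" for i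
  have "br (b i * x ^ i) a = F i + G i" for i
    unfolding F_def G_def br_mult_left br_power_left br_x[OF assms]
    by (cases i) (simp_all add: algebra_simps)
  then have "br (\<Sum>i\<le>Suc k. b i * x ^ i) a = (\<Sum>i\<le>Suc k. F i) + (\<Sum>i\<le>Suc k. G i)"
    by (simp only: br_sum_left sum.distrib)
  \<comment> \<open>\<open>G 0\<close> vanishes, so the \<open>de\<close>-part moves down one degree
    and meets the coefficient below.\<close>
  also have "(\<Sum>i\<le>Suc k. G i) = (\<Sum>i\<le>k. G (Suc i))"
    by (simp only: sum.atMost_Suc_shift) (simp add: G_def)
  also have "(\<Sum>i\<le>Suc k. F i) + \<dots> = (\<Sum>i\<le>k. F i + G (Suc i)) + F (Suc k)"
    by (simp add: sum.distrib algebra_simps)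
  finally show ?thesis
    by (simp add: F_def G_def algebra_simps)
qed

text \<open>\<open>t\<close> is the top coefficient of {f, a}, so \<open>b (Suc k)\<close> times {f,
  a} minus \<open>t\<close> times f has degree at most \<open>k\<close>, and minimality puts its
  coefficients into \<open>P\<close>. The one at \<open>x ^ k\<close> is displayed; multiplied by
  \<open>of_nat (Suc k)\<close> it is the expression of \<open>linear_bracket\<close> for
  \<open>u = of_nat (Suc k) * b (Suc k)\<close> and \<open>c = b k\<close>.\<close>

lemma top_bracket:
  assumes min: "\<And>d. d < Suc k \<Longrightarrow> \<not> has_lead d"
    and b: "\<And>i. b i \<in> B" and f: "(\<Sum>i\<le>Suc k. b i * x ^ i) \<in> P" and a: "a \<in> B"
  shows "b (Suc k) * br (b k) a - b k * br (b (Suc k)) a - b (Suc k) * b k * al a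
    + of_nat (Suc k) * (b (Suc k) * b (Suc k)) * de a \<in> P"
proof -
  define g where
    "g i = br (b i) a + of_nat i * b i * al a + of_nat (Suc i) * b (Suc i) * de a" for i
  define t where "t = br (b (Suc k)) a + of_nat (Suc k) * b (Suc k) * al a"
  have gB: "g i \<in> B" for i
    unfolding g_def by (intro add_B mult_B br_B of_nat_B al_B de_B b a)
  have tB: "t \<in> B"
    unfolding t_def by (intro add_B mult_B br_B of_nat_B al_B b a)
  have brf: "br (\<Sum>i\<le>Suc k. b i * x ^ i) a = (\<Sum>i\<le>k. g i * x ^ i) + t * x ^ Suc k"
    unfolding g_def t_def by (rule br_poly[OF a])
  \<comment> \<open>\<open>br_P\<close> expects the member of \<open>P\<close> in the second slot,
    hence the minus sign.\<close>
  have "- (b (Suc k) * br a (\<Sum>i\<le>Suc k. b i * x ^ i)) - t * (\<Sum>i\<le>Suc k. b i * x ^ i) \<in> P"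
    by (intro diff_P minus_P mult_P br_P f B_sub_S b a tB)
  also have "- (b (Suc k) * br a (\<Sum>i\<le>Suc k. b i * x ^ i)) - t * (\<Sum>i\<le>Suc k. b i * x ^ i)
     = b (Suc k) * ((\<Sum>i\<le>k. g i * x ^ i) + t * x ^ Suc k)
       - t * ((\<Sum>i\<le>k. b i * x ^ i) + b (Suc k) * x ^ Suc k)"
    unfolding brf[symmetric] br_anti[of a "sum _ _"] by simp
  also have "\<dots> = (\<Sum>i\<le>k. (b (Suc k) * g i - t * b i) * x ^ i)"
    by (simp add: sum_distrib_left sum_subtractf left_diff_distrib right_diff_distrib mult_ac distrib_left)
  finally have "(\<Sum>i<Suc k. (b (Suc k) * g i - t * b i) * x ^ i) \<in> P"
    by (simp only: lessThan_Suc_atMost)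
  then have "b (Suc k) * g k - t * b k \<in> P"
    using coeffs_P[of "Suc k" "\<lambda>i. b (Suc k) * g i - t * b i" k] min
    by (auto intro!: diff_B mult_B b gB tB)
  then show ?thesis
    by (simp add: g_def t_def algebra_simps)
qed

text \<open>
  The bracket with \<open>y\<close> is \<open>{y, p} = y (E p - s y \<partial>p/\<partial>x)\<close>, where \<open>E\<close> is the Euler operator of the
  grading. As \<open>E f = w f\<close>, the element \<open>y\<^sup>2 \<partial>f/\<partial>x\<close> lies in \<open>P\<close>, and \<open>\<partial>f/\<partial>x\<close> does not by
  minimality of \<open>m\<close>. Below, \<open>z = m b y\<close> clears the denominators.
\<close>

lemma minimal_linear:
  assumes min: "\<And>d. d < Suc k \<Longrightarrow> \<not> has_lead d"
    and b: "\<And>i. b i \<in> B" and f: "(\<Sum>i\<le>Suc k. b i * x ^ i) \<in> P" and lead: "b (Suc k) \<notin> P"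
    and hom: "\<And>i. al (b i) = sc (w - of_nat i * s) * b i"
  shows "of_nat (Suc k) * b (Suc k) * x + b k \<in> P"
proof -
  define m :: 'a where "m = of_nat (Suc k)"
  define u where "u = b (Suc k)"
  define c where "c = b k"
  define z where "z = m * u * x + c"
  define \<beta> where "\<beta> = w - of_nat (Suc k) * s"
  \<comment> \<open>\<open>K a\<close> is \<open>m * u * u\<close> times {y, a} - \<alpha>(a) y,
    where \<open>z = m * u * y\<close>.\<close>
  define K where "K a = u * br c a - c * br u a - u * c * al a + m * (u * u) * de a" for a
  have uB: "u \<in> B" and cB: "c \<in> B" and mB: "m \<in> B" by (simp_all add: u_def c_def m_def b of_nat_B del: of_nat_Suc)
  have uP: "u \<notin> P" using lead by (simp add: u_def)
  have zS: "z \<in> S"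
    unfolding z_def by (intro add_S mult_S B_sub_S x_S uB cB mB)
  have alu: "al u = sc \<beta> * u"
    by (simp only: u_def hom \<beta>_def)
  have "w - of_nat k * s = \<beta> + s"
    by (simp add: \<beta>_def algebra_simps)
  then have alc: "al c = sc \<beta> * c + sc s * c"
    by (simp add: c_def hom sc_add distrib_right)
  have m_cancel: "a \<in> P" if "m * a \<in> P" for a
    using of_nat_cancel_P[of "Suc k" a] that by (simp add: m_def)
  have u_cancel: "a \<in> P" if "u * a \<in> P" "a \<in> S" for a
    using cancel_P[of u a] that uP uB B_sub_S by blast
  have br_m: "br (m * p) q = m * br p q" for p q
    using br_sc_left[of "of_nat (Suc k)" q] by (simp add: br_mult_left m_def sc_of_nat del: of_nat_Suc)
  have KP: "K a \<in> P" if "a \<in> B" for a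
    using top_bracket[OF min b f that] unfolding K_def m_def u_def c_def by simp
  have brz: "br z a = m * (br u a * x + u * (al a * x + de a)) + br c a" if "a \<in> B" for a
    unfolding z_def mult.assoc[of m] br_add_left br_m
    unfolding br_mult_left br_x[OF that] by simp
  have K: "u * br z a - z * (br u a + u * al a) = K a" if "a \<in> B" for a
    unfolding brz[OF that] K_def by (simp add: z_def algebra_simps)
  \<comment> \<open>The relation for \<open>a = u\<close> with one factor \<open>u\<close>
    cancelled: {z, u} equals \<beta> u z modulo \<open>P\<close>.\<close>
  define q where "q = br z u - sc \<beta> * u * z"
  have qS: "q \<in> S"
    unfolding q_def by (intro diff_S mult_S br_S zS B_sub_S sc_B uB)
  have "u * q = K u"
    unfolding K[OF uB, symmetric] q_def by (simp add: br_self alu algebra_simps)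
  then have qP: "q \<in> P"
    using KP[OF uB] qS u_cancel by simp
  \<comment> \<open>The analogue of \<open>K\<close> for \<open>x\<close> itself:
    \<open>m * m * u * u\<close> times {y, x} - y (s x - s y), as E x = s x.\<close>
  define N where "N = m * u * br z x - z * (m * u * (sc s * x) - sc s * z + m * br u x)"
  have NS: "N \<in> S"
    unfolding N_def by (intro diff_S mult_S add_S br_S zS B_sub_S sc_B uB mB x_S)
  \<comment> \<open>Expanding {z, z} = 0 in one slot expresses {z, x} through the brackets of
    \<open>z\<close> with \<open>u\<close> and \<open>c\<close>, which \<open>K\<close>
    controls.\<close>
  have zz: "m * u * br z x + m * br z u * x + br z c = 0"
  proof -
    have "br z z = br z (m * u * x) + br z c"
      by (subst (2) z_def) (rule br_add_right)
    also have "br z (m * u * x) = m * (br z u * x + u * br z x)"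
      using br_m[of "u * x" z] br_anti[of z "m * u * x"] br_anti[of z "u * x"]
      by (simp add: br_mult_right[symmetric] mult.assoc)
    finally show ?thesis by (simp add: br_self algebra_simps)
  qed
  have brzu: "br z u = m * (u * br x u) + br c u"
    unfolding z_def mult.assoc[of m] br_add_left br_m
    unfolding br_mult_left by (simp add: br_self)
  have "m * (u * N) = m * (c * q - K c)"
  proof -
    have 1: "br z u = q + sc \<beta> * u * z"
      by (simp add: q_def)
    have 2: "br u x = - br x u" and 3: "br u c = - br c u"
      by (rule br_anti)+
    have 4: "br c u = q + sc \<beta> * u * z - m * (u * br x u)"
      using brzu 1 by simp
    have 5: "u * br z c = K c + z * (br u c + u * al c)"
      using K[OF cB] by (simp add: algebra_simps)
    have 6: "m * u * br z x = - (m * br z u * x) - br z c"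
      using zz by (simp add: eq_neg_iff_add_eq_0 algebra_simps)
    have "m * (u * N) = m * u * (- (m * br z u * x)) - m * (u * br z c)
      - m * u * z * (m * u * (sc s * x) - sc s * z + m * br u x)"
      unfolding N_def 6 by (simp add: algebra_simps)
    also have "\<dots> = m * (c * q - K c)"
      unfolding 5 3 2 alc 4 1 by (simp add: z_def algebra_simps)
    finally show ?thesis .
  qed
  moreover have "m * (c * q - K c) \<in> P"
    by (intro mult_P diff_P qP KP cB B_sub_S mB)
  ultimately have "m * (u * N) \<in> P" by (simp only:)
  then have NP: "N \<in> P"
    by (intro u_cancel[OF m_cancel NS])
  define f where "f = (\<Sum>i\<le>Suc k. b i * x ^ i)"
  define f' where "f' = (\<Sum>i\<le>Suc k. of_nat i * b i * x ^ (i - 1))"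
  have fP: "f \<in> P" using f by (simp add: f_def)
  have f'S: "f' \<in> S"
    unfolding f'_def by (intro sum_S adjoin_term mult_B of_nat_B b)
  \<comment> \<open>By the Leibniz rule the coefficient contributes \<open>K (b i)\<close> and each
    of the \<open>i\<close> factors \<open>x\<close> contributes \<open>N\<close>. By
    \<open>hom\<close> the weights of \<open>b i\<close> and \<open>x ^ i\<close> add up to
    \<open>w\<close> for every \<open>i\<close>.\<close>
  have summand: "m * u * br z (b i * x ^ i)
      - z * (m * u * (sc w * (b i * x ^ i)) - sc s * z * (of_nat i * b i * x ^ (i - 1))
             + m * br u (b i * x ^ i))
      = m * K (b i) * x ^ i + of_nat i * b i * x ^ (i - 1) * N" for i
  proof (cases i)
    case 0
    then show ?thesis
      unfolding K[OF b, symmetric] by (simp add: hom algebra_simps)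
  next
    case (Suc j)
    show ?thesis
      unfolding K[OF b, symmetric] N_def br_mult_right br_power_right hom Suc
      by (simp add: sc_diff sc_mult sc_of_nat sc_add sc_1 algebra_simps)
  qed
  have "m * u * br z f - z * (m * u * (sc w * f) - sc s * z * f' + m * br u f)
      = (\<Sum>i\<le>Suc k. m * K (b i) * x ^ i + of_nat i * b i * x ^ (i - 1) * N)"
    unfolding summand[symmetric] f_def f'_def br_sum_right
    by (simp only: sum_distrib_left[symmetric] sum.distrib sum_subtractf)
  also have "\<dots> \<in> P"
    by (intro sum_P add_P mult_P' mult_P KP NP b power_S x_S mult_S B_sub_S of_nat_B mB)
  finally have 1: "m * u * br z f - z * (m * u * (sc w * f) - sc s * z * f' + m * br u f) \<in> P" .
  \<comment> \<open>All terms with \<open>f\<close> or a bracket of \<open>f\<close> lie in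
    \<open>P\<close>; removing them isolates the term with \<open>f'\<close>.\<close>
  have "z * (m * u * (sc w * f) + m * br u f) - m * u * br z f \<in> P"
    by (intro diff_P mult_P add_P br_P fP zS mult_S B_sub_S mB uB sc_B)
  from add_P[OF 1 this] have "sc s * (z * (z * f')) \<in> P"
    by (simp add: algebra_simps)
  then have "z * (z * f') \<in> P"
    by (rule sc_cancel_P[OF s_nz])
  \<comment> \<open>\<open>f'\<close> has degree at most \<open>k\<close> with top coefficient
    \<open>of_nat (Suc k) * b (Suc k)\<close>, which avoids \<open>P\<close> in characteristic zero;
    membership would contradict minimality.\<close>
  moreover have "f' \<notin> P"
  proof
    assume "f' \<in> P"
    moreover have "f' = (\<Sum>i<Suc k. (of_nat (Suc i) * b (Suc i)) * x ^ i)"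
      unfolding f'_def sum.atMost_Suc_shift lessThan_Suc_atMost by simp
    ultimately have "of_nat (Suc k) * b (Suc k) \<in> P"
      using coeffs_P[of "Suc k" "\<lambda>i. of_nat (Suc i) * b (Suc i)" k] min b
      by (auto intro!: mult_B of_nat_B simp del: of_nat_Suc)
    then show False
      using of_nat_cancel_P[of "Suc k"] lead by blast
  qed
  ultimately have "z \<in> P"
    using cancel_P[OF zS _ mult_S[OF zS f'S]] cancel_P[OF zS _ f'S] by blast
  then show ?thesis by (simp add: z_def m_def u_def c_def)
qed

lemma linear_element:
  assumes graded: "\<And>d b. \<lbrakk>\<And>i. b i \<in> B; (\<Sum>i\<le>d. b i * x ^ i) \<in> P; b d \<notin> P\<rbrakk> \<Longrightarrow>
      \<exists>w b'. (\<forall>i. b' i \<in> B) \<and> (\<Sum>i\<le>d. b' i * x ^ i) \<in> P \<and> b' d \<notin> P \<and>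
        (\<forall>i. al (b' i) = sc (w - of_nat i * s) * b' i)"
    and ex: "has_lead d"
  obtains u c \<beta> where "u \<in> B" "c \<in> B" "u \<notin> P" "u * x + c \<in> P"
    "al u = sc \<beta> * u" "al c = sc (\<beta> + s) * c"
proof -
  define m where "m = (LEAST d. has_lead d)"
  have "has_lead m" and min: "\<And>d. d < m \<Longrightarrow> \<not> has_lead d"
    unfolding m_def using LeastI[of has_lead, OF ex] not_less_Least[of _ has_lead] by blast+
  then obtain w b where b: "\<And>i. b i \<in> B" "(\<Sum>i\<le>m. b i * x ^ i) \<in> P" "b m \<notin> P"
      "\<And>i. al (b i) = sc (w - of_nat i * s) * b i"
    using graded unfolding has_lead_def by metis
  \<comment> \<open>In degree zero the element is its own leading coefficient, which cannot be both
    inside and outside \<open>P\<close>.\<close>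
  obtain k where m: "m = Suc k"
    using b(2,3) by (cases m) auto
  \<comment> \<open>A derivation kills integers, so the factor \<open>of_nat m\<close> in
    \<open>u = of_nat m * b m\<close> leaves the eigenvalue of \<open>b m\<close> unchanged.\<close>
  have al_of_nat: "al (of_nat j) = 0" for j
  proof (induction j)
    case 0
    show ?case using al_add[OF zero_B zero_B] by simp
  next
    case (Suc j)
    have "al 1 = 0" using al_mult[OF one_B one_B] by simp
    then show ?case using Suc al_add[OF of_nat_B[of j] one_B] by (simp add: add.commute)
  qed
  show ?thesis
  proof (rule that)
    show "of_nat m * b m * x + b k \<in> P"
      using minimal_linear[of k b w] min b m by simp
    show "of_nat m * b m \<notin> P"
      using of_nat_cancel_P[of m] b(3) m by blast
    show "al (of_nat m * b m) = sc (w - of_nat m * s) * (of_nat m * b m)"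
      by (simp add: al_mult of_nat_B b al_of_nat mult_ac)
    show "al (b k) = sc (w - of_nat m * s + s) * b k"
      unfolding b(4) m by (simp add: algebra_simps)
  qed (intro mult_B of_nat_B b)+
qed

text \<open>Pseudo-division by a linear polynomial, with powers of \<open>u\<close> clearing
  denominators. Such representations can be added and multiplied, so induction over the generators
  of \<open>S\<close> suffices.\<close>

lemma reduce_mod_linear:
  assumes "u \<in> B" "c \<in> B" "a \<in> S"
  shows "\<exists>N. \<exists>q\<in>S. \<exists>r\<in>B. u ^ N * a = (u * x + c) * q + r"
  using assms(3)
proof (induction rule: S_induct)
  case (B b)
  then show ?case
    by (intro exI[of _ 0] bexI[of _ 0] bexI[of _ b]) (simp_all add: B_sub_S zero_B)
next
  case x
  show ?case
    by (intro exI[of _ 1] bexI[of _ 1] bexI[of _ "- c"]) (simp_all add: B_sub_S one_B minus_B assms)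
next
  case (add a b)
  then obtain N q r M q' r' where 1: "q \<in> S" "r \<in> B" "u ^ N * a = (u * x + c) * q + r"
    and 2: "q' \<in> S" "r' \<in> B" "u ^ M * b = (u * x + c) * q' + r'" by blast
  have uS: "u ^ i \<in> S" and uB: "u ^ i \<in> B" for i
    using assms(1) by (induction i) (simp_all add: one_B mult_B B_sub_S mult_S)
  have "u ^ (N + M) * (a + b) = u ^ M * (u ^ N * a) + u ^ N * (u ^ M * b)"
    by (simp add: power_add algebra_simps)
  also have "\<dots> = (u * x + c) * (u ^ M * q + u ^ N * q') + (u ^ M * r + u ^ N * r')"
    unfolding 1 2 by (simp add: algebra_simps)
  finally show ?case
    using 1 2 uS uB by (blast intro: add_S mult_S add_B mult_B)
next
  case (mult a b)
  then obtain N q r M q' r' where 1: "q \<in> S" "r \<in> B" "u ^ N * a = (u * x + c) * q + r"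
    and 2: "q' \<in> S" "r' \<in> B" "u ^ M * b = (u * x + c) * q' + r'" by blast
  have "u ^ (N + M) * (a * b) = (u ^ N * a) * (u ^ M * b)"
    by (simp add: power_add algebra_simps)
  also have "\<dots> = (u * x + c) * (q * ((u * x + c) * q') + q * r' + r * q') + r * r'"
    unfolding 1 2 by (simp add: algebra_simps)
  finally show ?case
    using 1 2 assms(1,2) x_S by (blast intro: add_S mult_S mult_B B_sub_S)
qed

section \<open>Primes extended from their contraction\<close>

lemma adjoin_contraction_subset: "adjoin (P \<inter> B) x \<subseteq> P"
  unfolding adjoin_def by (auto intro!: sum_P mult_P' power_S x_S)

text \<open>If no degree has a leading coefficient outside \<open>P\<close>, then
  \<open>coeffs_P\<close> puts every coefficient of every member of \<open>P\<close> into the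
  contraction.\<close>

lemma has_lead_or_adjoin:
  assumes "P \<noteq> adjoin (P \<inter> B) x"
  obtains d where "has_lead d"
proof (rule ccontr)
  assume "\<not> thesis"
  then have nl: "\<not> has_lead d" for d using that by blast
  have "a \<in> adjoin (P \<inter> B) x" if a: "a \<in> P" for a
  proof -
    obtain d b where b: "\<And>i. b i \<in> B" "a = (\<Sum>i\<le>d. b i * x ^ i)"
      using P_S[OF a] unfolding adjoin_def by blast
    have "b i \<in> P" if "i \<le> d" for i
      using coeffs_P[of "Suc d" b i] nl b a that by (auto simp: lessThan_Suc_atMost)
    then show ?thesis
      unfolding adjoin_def b(2)
      by (intro CollectI exI[of _ d] exI[of _ "\<lambda>i. if i \<le> d then b i else 0"])
        (auto simp: b zero_P zero_B)
  qed
  then show False using adjoin_contraction_subset assms by blast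
qed

end

section \<open>Iterated extensions with a torus action\<close>

context poisson_alg
begin

lemma kspan_0: "kspan sc x 0 = range sc"
proof (intro set_eqI iffI)
  fix a assume "a \<in> kspan sc x 0"
  then obtain M c where "a = (\<Sum>m\<in>M. sc (c m) * monom x 0 m)"
    unfolding kspan_def by blast
  moreover have "(\<Sum>m\<in>M. sc (c m)) = sc (\<Sum>m\<in>M. c m)" for M :: "(nat \<Rightarrow> nat) set" and c
    by (induction M rule: infinite_finite_induct) (simp_all add: sc_0 sc_add)
  ultimately show "a \<in> range sc" by (simp add: monom_def)
next
  fix a assume "a \<in> range sc"
  then obtain c where "a = sc c" by blast
  then show "a \<in> kspan sc x 0"
    unfolding kspan_def
    by (intro CollectI exI[of _ "{\<lambda>_. 0}"] exI[of _ "\<lambda>_. c"]) (auto simp: monom_def)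
qed

lemma sc_kspan: "sc c \<in> kspan sc x j"
  unfolding kspan_def
  by (intro CollectI exI[of _ "{\<lambda>_. 0}"] exI[of _ "\<lambda>_. c"]) (auto simp: monom_def)

lemma kspan_add:
  assumes "a \<in> kspan sc x j" "b \<in> kspan sc x j"
  shows "a + b \<in> kspan sc x j"
proof -
  obtain M c where M: "finite M" "\<forall>m\<in>M. \<forall>i. j \<le> i \<longrightarrow> m i = 0"
      "a = (\<Sum>m\<in>M. sc (c m) * monom x j m)"
    using assms(1) unfolding kspan_def by blast
  obtain N d where N: "finite N" "\<forall>m\<in>N. \<forall>i. j \<le> i \<longrightarrow> m i = 0"
      "b = (\<Sum>m\<in>N. sc (d m) * monom x j m)"
    using assms(2) unfolding kspan_def by blast
  let ?c = "\<lambda>m. if m \<in> M then c m else 0" and ?d = "\<lambda>m. if m \<in> N then d m else 0"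
  have "a = (\<Sum>m\<in>M \<union> N. sc (?c m) * monom x j m)" "b = (\<Sum>m\<in>M \<union> N. sc (?d m) * monom x j m)"
    unfolding M(3) N(3) using M(1) N(1) by (intro sum.mono_neutral_cong_left; auto simp: sc_0)+
  then have "a + b = (\<Sum>m\<in>M \<union> N. sc (?c m + ?d m) * monom x j m)"
    by (simp only: sc_add distrib_right sum.distrib)
  then show ?thesis
    unfolding kspan_def using M(1,2) N(1,2)
    by (intro CollectI exI[of _ "M \<union> N"] exI[of _ "\<lambda>m. ?c m + ?d m"]) auto
qed

lemma kspan_sum: "(\<And>i. i \<in> I \<Longrightarrow> f i \<in> kspan sc x j) \<Longrightarrow> (\<Sum>i\<in>I. f i) \<in> kspan sc x j"
  using sc_kspan[of 0 x j] by (induction I rule: infinite_finite_induct) (auto simp: kspan_add sc_0)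

text \<open>Sorting monomials by the exponent of \<open>x j\<close> turns the flat span into an
  iterated one-variable extension, to which \<open>poisson_ext\<close> applies.\<close>

lemma kspan_Suc: "kspan sc x (Suc j) = adjoin (kspan sc x j) (x j)"
proof (intro set_eqI iffI)
  fix a assume "a \<in> kspan sc x (Suc j)"
  then obtain M c where M: "finite M" "a = (\<Sum>m\<in>M. sc (c m) * monom x (Suc j) m)"
    unfolding kspan_def by blast
  define d where "d = Max ((\<lambda>m. m j) ` M)"
  define b where "b i = (\<Sum>m\<in>{m\<in>M. m j = i}. sc (c m) * monom x j m)" for i
  have mon: "sc c * monom x j m \<in> kspan sc x j" for c m
  proof -
    \<comment> \<open>Exponents from \<open>j\<close> on do not affect \<open>monom x j m\<close>,
      but \<open>kspan\<close> demands that they be zero.\<close>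
    have "monom x j m = monom x j (\<lambda>i. if i < j then m i else 0)"
      unfolding monom_def by (rule prod.cong) auto
    then show ?thesis
      unfolding kspan_def
      by (intro CollectI exI[of _ "{\<lambda>i. if i < j then m i else 0}"] exI[of _ "\<lambda>_. c"]) auto
  qed
  have "a = (\<Sum>i\<le>d. \<Sum>m\<in>{m\<in>M. m j = i}. sc (c m) * monom x (Suc j) m)"
    unfolding M(2) by (rule sum.group[symmetric]) (auto simp: M(1) d_def)
  also have "\<dots> = (\<Sum>i\<le>d. b i * x j ^ i)"
    unfolding b_def sum_distrib_right
    by (intro sum.cong) (auto simp: monom_def mult_ac)
  finally show "a \<in> adjoin (kspan sc x j) (x j)"
    unfolding adjoin_def using mon
    by (intro CollectI exI[of _ d] exI[of _ b]) (auto simp: b_def intro!: kspan_sum)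
next
  fix a assume "a \<in> adjoin (kspan sc x j) (x j)"
  then obtain d b where b: "\<And>i. b i \<in> kspan sc x j" "a = (\<Sum>i\<le>d. b i * x j ^ i)"
    unfolding adjoin_def by blast
  have "b i * x j ^ i \<in> kspan sc x (Suc j)" for i
  proof -
    obtain M c where M: "finite M" "\<And>m i. m \<in> M \<Longrightarrow> j \<le> i \<Longrightarrow> m i = 0"
        "b i = (\<Sum>m\<in>M. sc (c m) * monom x j m)"
      using b(1)[of i] unfolding kspan_def by blast
    \<comment> \<open>\<open>up\<close> multiplies a monomial by \<open>x j ^ i\<close>;
      \<open>down\<close> inverts it on \<open>M\<close>, where the exponent at \<open>j\<close> is
      zero.\<close>
    define up where "up m = m(j := i)" for m :: "nat \<Rightarrow> nat"
    define down where "down m = m(j := 0)" for m :: "nat \<Rightarrow> nat"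
    have down_up: "down (up m) = m" if "m \<in> M" for m
      using M(2)[OF that, of j] by (auto simp: up_def down_def)
    have "monom x (Suc j) (up m) = monom x j m * x j ^ i" for m
      by (simp add: monom_def up_def)
    then have "b i * x j ^ i = (\<Sum>m\<in>up ` M. sc (c (down m)) * monom x (Suc j) m)"
      unfolding M(3) sum_distrib_right
      by (subst sum.reindex) (auto intro!: inj_on_inverseI[of M down] sum.cong simp: down_up mult_ac)
    moreover have "m i = 0" if "m \<in> up ` M" "Suc j \<le> i" for m i
      using that M(2) by (auto simp: up_def)
    ultimately show ?thesis
      unfolding kspan_def using M(1)
      by (intro CollectI exI[of _ "up ` M"] exI[of _ "\<lambda>m. c (down m)"]) auto
  qed
  then show "a \<in> kspan sc x (Suc j)"
    unfolding b(2) by (rule kspan_sum)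
qed

end

text \<open>The last assumption normalises the weights: with zero entries from \<open>r\<close> on,
  different weights give different characters.\<close>

locale poisson_torus = poisson_alg sc br
  for sc :: "'k::field_char_0 \<Rightarrow> 'a::comm_ring_1" and br :: "'a \<Rightarrow> 'a \<Rightarrow> 'a" +
  fixes x :: "nat \<Rightarrow> 'a" and n r :: nat
    and al de :: "nat \<Rightarrow> 'a \<Rightarrow> 'a"
    and act :: "(nat \<Rightarrow> 'k) \<Rightarrow> 'a \<Rightarrow> 'a"
    and chi :: "nat \<Rightarrow> nat \<Rightarrow> int"
    and eta :: "nat \<Rightarrow> nat \<Rightarrow> 'k"
  assumes iter: "iterated_poisson sc br x n al de"
    and H: "rational_torus_action sc act r"
    and eig: "\<And>j. j < n \<Longrightarrow> x j \<in> eigsp sc act r (chi j)"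
    and eta_alpha: "\<And>i j. j < i \<Longrightarrow> i < n \<Longrightarrow> sc (dotp r (eta i) (chi j)) * x j = al i (x j)"
    and eta_nz: "\<And>i. i < n \<Longrightarrow> dotp r (eta i) (chi i) \<noteq> 0"
    and chi_supp: "\<And>i j. r \<le> i \<Longrightarrow> chi j i = 0"
begin

section \<open>Eigenspaces and characters of the torus\<close>

lemma act_add: "h \<in> torus r \<Longrightarrow> act h (a + b) = act h a + act h b"
  and act_mult: "h \<in> torus r \<Longrightarrow> act h (a * b) = act h a * act h b"
  and act_sc: "h \<in> torus r \<Longrightarrow> act h (sc c) = sc c"
  using H by (simp_all add: rational_torus_action_def)

lemma act_0: "h \<in> torus r \<Longrightarrow> act h 0 = 0"
  using act_sc[of h 0] by (simp add: sc_0)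

lemma act_sum: "h \<in> torus r \<Longrightarrow> act h (\<Sum>i\<in>I. f i) = (\<Sum>i\<in>I. act h (f i))"
  by (induction I rule: infinite_finite_induct) (simp_all add: act_0 act_add)

lemma eigsp_0: "0 \<in> eigsp sc act r w"
  and eigsp_add: "a \<in> eigsp sc act r w \<Longrightarrow> b \<in> eigsp sc act r w \<Longrightarrow> a + b \<in> eigsp sc act r w"
  and eigsp_sc: "sc c \<in> eigsp sc act r (\<lambda>_. 0)"
  by (simp_all add: eigsp_def act_0 act_add act_sc char_val_def sc_1 algebra_simps)

lemma eigsp_mult:
  assumes "a \<in> eigsp sc act r w" "b \<in> eigsp sc act r v"
  shows "a * b \<in> eigsp sc act r (\<lambda>l. w l + v l)"
proof -
  have "char_val r h (\<lambda>l. w l + v l) = char_val r h w * char_val r h v" if "h \<in> torus r" for h :: "nat \<Rightarrow> 'k"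
    using that by (auto simp: char_val_def torus_def power_int_add prod.distrib[symmetric] intro!: prod.cong)
  then show ?thesis
    using assms by (auto simp: eigsp_def act_mult sc_mult mult_ac)
qed

lemma eigsp_sc_mult: "a \<in> eigsp sc act r w \<Longrightarrow> sc c * a \<in> eigsp sc act r w"
  using eigsp_mult[OF eigsp_sc, of a w c] by simp

text \<open>In characteristic zero 2 has infinite multiplicative order, so the point with 2 in
  coordinate \<open>i\<close> and 1 elsewhere separates the two characters.\<close>

lemma separate_chars:
  assumes "u i \<noteq> v i" "i < r"
  obtains h where "h \<in> torus r" "char_val r h u \<noteq> (char_val r h v :: 'k)"
proof -
  define h :: "nat \<Rightarrow> 'k" where "h l = (if l = i then 2 else 1)" for l
  have val: "char_val r h w = 2 powi w i" for w
  proof -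
    have "char_val r h w = (\<Prod>l<r. if l = i then 2 powi w i else 1)"
      unfolding char_val_def h_def by (intro prod.cong) auto
    then show ?thesis using assms(2) by simp
  qed
  have pos: "(2::'k) powi a \<noteq> 2 powi b" if less: "a < b" for a b
  proof
    assume eq: "(2::'k) powi a = 2 powi b"
    obtain k where k: "b = a + int k" "0 < k"
      using zless_iff_Suc_zadd[of a b] less by blast
    have "(2::'k) ^ k = 1"
      using eq by (simp add: k(1) power_int_add)
    then have "of_nat (2 ^ k) = (of_nat 1 :: 'k)" by simp
    then have "2 ^ k = (1::nat)" by (simp only: of_nat_eq_iff)
    then show False using k(2) by simp
  qed
  have "(2::'k) powi u i \<noteq> 2 powi v i"
    using assms(1) pos[of "u i" "v i"] pos[of "v i" "u i"] by (metis linorder_neqE)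
  moreover have "h \<in> torus r"
    using assms(2) by (auto simp: torus_def h_def)
  ultimately show ?thesis using that val by metis
qed

text \<open>Independence of eigenvectors relative to a stable \<open>P\<close>. For \<open>h\<close>
  separating \<open>u\<close> from \<open>v\<close>, the operator \<open>act h\<close> minus the
  scalar of \<open>v\<close> kills the component at \<open>v\<close> and rescales the one at
  \<open>u\<close> by a nonzero factor.\<close>

lemma eigen_components:
  assumes "finite T"
    and "\<And>u. u \<in> T \<Longrightarrow> f u \<in> eigsp sc act r u" "\<And>u i. u \<in> T \<Longrightarrow> r \<le> i \<Longrightarrow> u i = 0"
    and P: "\<And>a b. a \<in> P \<Longrightarrow> b \<in> P \<Longrightarrow> a + b \<in> P" "\<And>c a. a \<in> P \<Longrightarrow> sc c * a \<in> P"
      "\<And>h a. h \<in> torus r \<Longrightarrow> a \<in> P \<Longrightarrow> act h a \<in> P"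
    and "(\<Sum>u\<in>T. f u) \<in> P" "u \<in> T"
  shows "f u \<in> P"
  using assms(1-3,7,8)
proof (induction T arbitrary: f u rule: finite_induct)
  case (insert v T)
  have diff: "a - b \<in> P" if "a \<in> P" "b \<in> P" for a b
    using P(1)[OF that(1) P(2)[OF that(2), of "- 1"]] by (simp add: sc_minus sc_1)
  have fT: "f u \<in> P" if u: "u \<in> T" for u
  proof -
    have "u \<noteq> v" using insert.hyps(2) u by blast
    then obtain i where i: "u i \<noteq> v i" by (auto simp: fun_eq_iff)
    then have "i < r" using insert.prems(2) u by (metis insertI1 insertI2 not_le)
    with i obtain h where h: "h \<in> torus r" "char_val r h u \<noteq> (char_val r h v :: 'k)"
      using separate_chars by blast
    define D where "D w = char_val r h w - char_val r h v" for w
    have eq: "act h (f w) = sc (char_val r h w) * f w" if "w \<in> insert v T" for w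
      using insert.prems(1)[OF that] h(1) by (simp add: eigsp_def)
    have "act h (\<Sum>w\<in>insert v T. f w) - sc (char_val r h v) * (\<Sum>w\<in>insert v T. f w) \<in> P"
      by (intro diff P insert.prems h)
    also have "act h (\<Sum>w\<in>insert v T. f w) - sc (char_val r h v) * (\<Sum>w\<in>insert v T. f w)
        = (\<Sum>w\<in>insert v T. sc (D w) * f w)"
      unfolding act_sum[OF h(1)] sum_distrib_left sum_subtractf[symmetric]
      by (intro sum.cong) (auto simp: eq D_def sc_diff algebra_simps)
    also have "\<dots> = (\<Sum>w\<in>T. sc (D w) * f w)"
      using insert.hyps by (simp add: D_def sc_0)
    finally have "sc (D u) * f u \<in> P"
      using insert.IH[of "\<lambda>w. sc (D w) * f w"] insert.prems(1,2) u by (simp add: eigsp_sc_mult)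
    then show ?thesis
      using P(2)[of "sc (D u) * f u" "inverse (D u)"] h(2) by (simp add: D_def sc_cancel)
  qed
  have "(\<Sum>u\<in>T. f u) \<in> P" if "T \<noteq> {}"
  proof -
    have "finite T' \<Longrightarrow> T' \<noteq> {} \<Longrightarrow> T' \<subseteq> T \<Longrightarrow> (\<Sum>u\<in>T'. f u) \<in> P" for T'
      by (induction T' rule: finite_ne_induct) (auto simp: fT P(1))
    then show ?thesis using insert.hyps(1) that by blast
  qed
  then have "f v \<in> P"
    using insert.prems(3) insert.hyps diff[of "\<Sum>u\<in>insert v T. f u" "\<Sum>u\<in>T. f u"]
    by (cases "T = {}") auto
  then show ?case using fT insert.prems(4) by auto
qed simp

text \<open>The bottom variable \<open>x 0\<close> comes with no twisting data; both maps vanish there.\<close>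

definition al' :: "nat \<Rightarrow> 'a \<Rightarrow> 'a" where "al' j = (if j = 0 then \<lambda>_. 0 else al j)"
definition de' :: "nat \<Rightarrow> 'a \<Rightarrow> 'a" where "de' j = (if j = 0 then \<lambda>_. 0 else de j)"

section \<open>The levels of the tower as Poisson extensions\<close>

lemma al'_sc_mult: "a \<in> kspan sc x j \<Longrightarrow> j < n \<Longrightarrow> al' j (sc c * a) = sc c * al' j a"
  using iter by (auto simp: iterated_poisson_def poisson_derivation_on_def derivation_on_def k_linear_on_def al'_def)

text \<open>Closure is a hypothesis here because it is itself proved by induction on the level:
  \<open>kspan_closed\<close> uses this lemma at level \<open>j\<close> to obtain closure at level
  \<open>Suc j\<close>.\<close>

lemma ext_if_closed:
  assumes j: "j < n"
    and "\<And>a b. a \<in> kspan sc x j \<Longrightarrow> b \<in> kspan sc x j \<Longrightarrow> a * b \<in> kspan sc x j"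
    and "\<And>a b. a \<in> kspan sc x j \<Longrightarrow> b \<in> kspan sc x j \<Longrightarrow> br a b \<in> kspan sc x j"
  shows "poisson_ext sc br (kspan sc x j) (x j) (al' j) (de' j) (dotp r (eta j) (chi j))"
proof (cases "j = 0")
  case True
  moreover have "br p b = 0" if "b \<in> kspan sc x 0" for p b
    using that by (auto simp: kspan_0 br_sc_right)
  ultimately show ?thesis
    using assms eta_nz[OF j] sc_kspan[of 0 x 0, unfolded sc_0]
    by unfold_locales (auto simp: al'_def de'_def sc_kspan kspan_add)
next
  case False
  with j have 1: "al j ` kspan sc x j \<subseteq> kspan sc x j" "de j ` kspan sc x j \<subseteq> kspan sc x j"
    and 2: "derivation_on sc (kspan sc x j) (al j)"
    and 3: "\<forall>b\<in>kspan sc x j. br (x j) b = al j b * x j + de j b"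
    using iter by (auto simp: iterated_poisson_def poisson_derivation_on_def)
  show ?thesis
    using assms eta_nz[OF j] 1 2 3 False
    by unfold_locales (auto simp: al'_def de'_def sc_kspan kspan_add derivation_on_def k_linear_on_def)
qed

lemma kspan_closed:
  assumes "j \<le> n"
  shows "(\<forall>a\<in>kspan sc x j. \<forall>b\<in>kspan sc x j. a * b \<in> kspan sc x j \<and> br a b \<in> kspan sc x j)"
  using assms
proof (induction j)
  case 0
  then show ?case
    by (auto simp: kspan_0 br_sc_right sc_mult[symmetric]) (metis rangeI sc_0)
next
  case (Suc j)
  then interpret poisson_ext sc br "kspan sc x j" "x j" "al' j" "de' j" "dotp r (eta j) (chi j)"
    by (intro ext_if_closed) auto
  show ?case
    by (auto simp: kspan_Suc mult_S br_S)
qed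

lemma ext:
  "j < n \<Longrightarrow> poisson_ext sc br (kspan sc x j) (x j) (al' j) (de' j) (dotp r (eta j) (chi j))"
  using kspan_closed[of j] by (intro ext_if_closed) auto

lemma act_kspan: "j \<le> n \<Longrightarrow> h \<in> torus r \<Longrightarrow> a \<in> kspan sc x j \<Longrightarrow> act h a \<in> kspan sc x j"
proof (induction j arbitrary: a)
  case 0
  then show ?case by (auto simp: kspan_0 act_sc)
next
  case (Suc j)
  then interpret poisson_ext sc br "kspan sc x j" "x j" "al' j" "de' j" "dotp r (eta j) (chi j)"
    by (intro ext) auto
  have x: "act h (x j) \<in> S"
    using eig[of j] Suc.prems mult_S[OF B_sub_S[OF sc_B] x_S] by (simp add: eigsp_def)
  have B: "act h b \<in> S" if "b \<in> kspan sc x j" for b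
    using Suc.IH[of b] Suc.prems(1,2) that B_sub_S by simp
  have "a \<in> S" using Suc.prems(3) by (simp only: kspan_Suc)
  then have "act h a \<in> S"
    by (induction rule: S_induct) (auto simp: B x act_add act_mult add_S mult_S Suc.prems(2))
  then show ?case by (simp only: kspan_Suc)
qed

lemma x_kspan: "j \<le> n \<Longrightarrow> t < j \<Longrightarrow> x t \<in> kspan sc x j"
proof (induction j)
  case (Suc j)
  then interpret poisson_ext sc br "kspan sc x j" "x j" "al' j" "de' j" "dotp r (eta j) (chi j)"
    by (intro ext) auto
  show ?case
    using Suc x_S B_sub_S unfolding kspan_Suc by (cases "t = j") auto
qed simp

text \<open>The last condition says that \<alpha> acts on the element as \<open>eta j\<close> does.
  For variables it is \<open>eta_alpha\<close>; it spreads to monomials because \<alpha> is a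
  derivation.\<close>

definition homog :: "nat \<Rightarrow> (nat \<Rightarrow> int) \<Rightarrow> 'a set" where
  "homog j w = {a \<in> kspan sc x j. a \<in> eigsp sc act r w \<and> al' j a = sc (dotp r (eta j) w) * a}"

definition weight :: "nat \<Rightarrow> (nat \<Rightarrow> nat) \<Rightarrow> nat \<Rightarrow> int" where
  "weight j m l = (\<Sum>t<j. int (m t) * chi t l)"

section \<open>Homogeneous elements and weight decompositions\<close>

lemma dotp_add: "dotp r e (\<lambda>l. u l + v l) = dotp r e u + dotp r e v"
  by (simp add: dotp_def sum.distrib algebra_simps)

lemma dotp_diff_mult: "dotp r e (\<lambda>l. u l - int i * v l) = dotp r e u - of_nat i * dotp r e v"
  by (simp add: dotp_def sum_subtractf sum_distrib_left algebra_simps)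

lemma homog_mult:
  assumes "j < n" "a \<in> homog j u" "b \<in> homog j v"
  shows "a * b \<in> homog j (\<lambda>l. u l + v l)"
proof -
  interpret poisson_ext sc br "kspan sc x j" "x j" "al' j" "de' j" "dotp r (eta j) (chi j)"
    by (rule ext[OF assms(1)])
  show ?thesis
    using assms by (auto simp: homog_def mult_B eigsp_mult al_mult dotp_add sc_add algebra_simps)
qed

lemma homog_1: "j < n \<Longrightarrow> 1 \<in> homog j (\<lambda>_. 0)"
proof -
  assume "j < n"
  then interpret poisson_ext sc br "kspan sc x j" "x j" "al' j" "de' j" "dotp r (eta j) (chi j)"
    by (rule ext)
  show ?thesis
    using al_mult[OF one_B one_B] eigsp_sc[of 1] by (simp add: homog_def one_B dotp_def sc_0 sc_1)
qed

lemma homog_sum: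
  assumes "j < n" "\<And>i. i \<in> I \<Longrightarrow> f i \<in> homog j w"
  shows "(\<Sum>i\<in>I. f i) \<in> homog j w"
proof -
  interpret poisson_ext sc br "kspan sc x j" "x j" "al' j" "de' j" "dotp r (eta j) (chi j)"
    by (rule ext[OF assms(1)])
  have 0: "0 \<in> homog j w"
    using al_add[OF zero_B zero_B] by (simp add: homog_def zero_B eigsp_0)
  have "a + b \<in> homog j w" if "a \<in> homog j w" "b \<in> homog j w" for a b
    using that by (simp add: homog_def add_B eigsp_add al_add algebra_simps)
  then show ?thesis
    using assms(2) 0 by (induction I rule: infinite_finite_induct) auto
qed

lemma homog_sc_mult: "j < n \<Longrightarrow> a \<in> homog j w \<Longrightarrow> sc c * a \<in> homog j w"
  using kspan_closed[of j]
  by (auto simp: homog_def al'_sc_mult eigsp_sc_mult sc_kspan mult.left_commute)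

lemma homog_x_power:
  assumes "j < n" "t < j"
  shows "x t ^ i \<in> homog j (\<lambda>l. int i * chi t l)"
proof (induction i)
  case 0
  show ?case using homog_1[OF assms(1)] by simp
next
  case (Suc i)
  have "x t \<in> homog j (chi t)"
    using assms eig[of t] x_kspan[of j t] eta_alpha[of t j] by (simp add: homog_def al'_def)
  from homog_mult[OF assms(1) this Suc] show ?case by (simp add: algebra_simps)
qed

lemma homog_monom: "j < n \<Longrightarrow> k \<le> j \<Longrightarrow> monom x k m \<in> homog j (weight k m)"
proof (induction k)
  case 0
  then show ?case using homog_1 by (simp add: monom_def weight_def[abs_def])
next
  case (Suc k)
  have "weight (Suc k) m = (\<lambda>l. weight k m l + int (m k) * chi k l)"
    by (simp add: weight_def[abs_def])
  then show ?case
    using homog_mult[OF Suc.prems(1) Suc.IH homog_x_power[of j k "m k"]] Suc.prems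
    by (simp add: monom_def)
qed

text \<open>Monomials are grouped by weight. The zero values of \<open>g\<close> off
  \<open>T\<close> later allow several coefficients to share one index set.\<close>

lemma homog_decomposition:
  assumes "j < n" "a \<in> kspan sc x j"
  obtains T g where "finite T" "\<And>w i. w \<in> T \<Longrightarrow> r \<le> i \<Longrightarrow> w i = 0" "\<And>w. g w \<in> homog j w"
    "\<And>w. w \<notin> T \<Longrightarrow> g w = 0" "a = (\<Sum>w\<in>T. g w)"
proof -
  obtain M c where M: "finite M" "a = (\<Sum>m\<in>M. sc (c m) * monom x j m)"
    using assms(2) unfolding kspan_def by blast
  define g where "g w = (\<Sum>m\<in>{m. m \<in> M \<and> weight j m = w}. sc (c m) * monom x j m)" for w
  show ?thesis
  proof (rule that)
    show "a = (\<Sum>w\<in>weight j ` M. g w)"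
      unfolding M(2) g_def by (rule sum.image_gen[OF M(1)])
    show "g w \<in> homog j w" for w
      unfolding g_def using homog_monom[of j j] assms(1)
      by (intro homog_sum) (auto intro: homog_sc_mult)
    show "g w = 0" if "w \<notin> weight j ` M" for w
      unfolding g_def using that by (intro sum.neutral) auto
  qed (use M(1) chi_supp in \<open>auto simp: weight_def\<close>)
qed

section \<open>Torus-stable primes: contraction, fibres and counting\<close>

definition primes :: "nat \<Rightarrow> 'a set set" where
  "primes j = {P. poisson_prime_in br (kspan sc x j) P \<and> (\<forall>h\<in>torus r. \<forall>a\<in>P. act h a \<in> P)}"

lemma ext_prime:
  assumes "j < n" "P \<in> primes (Suc j)"
  shows "poisson_ext_prime sc br (kspan sc x j) (x j) (al' j) (de' j) (dotp r (eta j) (chi j)) P"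
  using assms ext[OF assms(1)]
  by (simp add: poisson_ext_prime_def poisson_ext_prime_axioms_def primes_def kspan_Suc)

text \<open>Provides the hypothesis \<open>graded\<close> of \<open>linear_element\<close>: the
  homogeneous components of a member of a stable prime stay in it, and one of them keeps a leading
  coefficient outside \<open>P\<close>.\<close>

lemma homogeneous_lead:
  assumes j: "j < n" and P: "P \<in> primes (Suc j)"
    and b: "\<And>i. b i \<in> kspan sc x j" "(\<Sum>i\<le>d. b i * x j ^ i) \<in> P" "b d \<notin> P"
  shows "\<exists>w b'. (\<forall>i. b' i \<in> kspan sc x j) \<and> (\<Sum>i\<le>d. b' i * x j ^ i) \<in> P \<and> b' d \<notin> P \<and>
    (\<forall>i. al' j (b' i) = sc (w - of_nat i * dotp r (eta j) (chi j)) * b' i)"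
proof -
  interpret poisson_ext_prime sc br "kspan sc x j" "x j" "al' j" "de' j" "dotp r (eta j) (chi j)" P
    by (rule ext_prime[OF j P])
  have "\<exists>T g. finite T \<and> (\<forall>w\<in>T. \<forall>l. r \<le> l \<longrightarrow> w l = 0) \<and> (\<forall>w. g w \<in> homog j w) \<and>
      (\<forall>w. w \<notin> T \<longrightarrow> g w = 0) \<and> b i = (\<Sum>w\<in>T. g w)" for i
    using homog_decomposition[OF j b(1)[of i]] by metis
  then obtain T g where T: "\<And>i. finite (T i)" "\<And>i w l. w \<in> T i \<Longrightarrow> r \<le> l \<Longrightarrow> w l = 0"
    and g: "\<And>i w. g i w \<in> homog j w" "\<And>i w. w \<notin> T i \<Longrightarrow> g i w = 0"
      "\<And>i. b i = (\<Sum>w\<in>T i. g i w)"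
    by metis
  \<comment> \<open>A coefficient of weight \<open>w\<close> at \<open>x j ^ i\<close> belongs to
    total weight \<open>up i w\<close>; \<open>down i\<close> returns from the total weight to that
    of the coefficient.\<close>
  define up :: "nat \<Rightarrow> (nat \<Rightarrow> int) \<Rightarrow> nat \<Rightarrow> int" where "up i w = (\<lambda>l. w l + int i * chi j l)" for i w
  define down :: "nat \<Rightarrow> (nat \<Rightarrow> int) \<Rightarrow> nat \<Rightarrow> int" where "down i w = (\<lambda>l. w l - int i * chi j l)" for i w
  have down_up: "down i (up i w) = w" and up_down: "up i (down i w) = w" for i w
    by (simp_all add: up_def down_def)
  define U where "U = (\<Union>i\<le>d. up i ` T i)"
  have finU: "finite U" using T(1) by (simp add: U_def)
  have suppU: "w l = 0" if "w \<in> U" "r \<le> l" for w l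
    using that T(2) chi_supp by (auto simp: U_def up_def)
  have b_eq: "b i = (\<Sum>u\<in>U. g i (down i u))" if "i \<le> d" for i
  proof -
    have "b i = (\<Sum>u\<in>up i ` T i. g i (down i u))"
      unfolding g(3)[of i]
      by (subst sum.reindex) (auto intro!: inj_on_inverseI[of _ "down i"] simp: down_up)
    also have "\<dots> = (\<Sum>u\<in>U. g i (down i u))"
      using that by (intro sum.mono_neutral_left finU)
        (auto simp: U_def intro!: g(2) imageI dest: imageI[of _ _ "up i"] simp: up_down)
    finally show ?thesis .
  qed
  define f where "f u = (\<Sum>i\<le>d. g i (down i u) * x j ^ i)" for u
  have x_pow: "x j ^ i \<in> eigsp sc act r (\<lambda>l. int i * chi j l)" for i
  proof (induction i)
    case 0
    show ?case using eigsp_sc[of 1] by (simp add: sc_1)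
  next
    case (Suc i)
    from eigsp_mult[OF eig[OF j] this] show ?case by (simp add: algebra_simps)
  qed
  have f_eig: "f u \<in> eigsp sc act r u" for u
  proof -
    have 1: "g i (down i u) * x j ^ i \<in> eigsp sc act r u" for i
      using eigsp_mult[OF _ x_pow, of "g i (down i u)" "down i u" i] g(1)[of i "down i u"]
      by (simp add: homog_def down_def)
    have 2: "(\<Sum>i\<in>I. F i) \<in> eigsp sc act r u" if "\<And>i. F i \<in> eigsp sc act r u"
      for F and I :: "nat set"
      using that by (induction I rule: infinite_finite_induct) (auto simp: eigsp_0 eigsp_add)
    show ?thesis unfolding f_def by (rule 2[OF 1])
  qed
  have "(\<Sum>i\<le>d. b i * x j ^ i) = (\<Sum>u\<in>U. f u)"
    unfolding f_def by (subst sum.swap) (simp add: b_eq sum_distrib_right)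
  then have "(\<Sum>u\<in>U. f u) \<in> P" using b(2) by simp
  then have fP: "f u \<in> P" if "u \<in> U" for u
    using eigen_components[of U f P u] finU f_eig suppU that P add_P mult_P[OF B_sub_S[OF sc_B]]
    by (auto simp: primes_def)
  \<comment> \<open>\<open>b d\<close> is the sum of these components, so they cannot all lie in
    \<open>P\<close>.\<close>
  obtain u where u: "u \<in> U" "g d (down d u) \<notin> P"
    using b(3) b_eq[of d] sum_P[of U "\<lambda>u. g d (down d u)"] by auto
  show ?thesis
  proof (intro exI[of _ "dotp r (eta j) u"] exI[of _ "\<lambda>i. g i (down i u)"] conjI allI)
    show "al' j (g i (down i u)) = sc (dotp r (eta j) u - of_nat i * dotp r (eta j) (chi j)) * g i (down i u)" for i
      using g(1)[of i "down i u"] unfolding homog_def by (simp add: down_def dotp_diff_mult)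
  qed (use g(1) u fP in \<open>auto simp: f_def homog_def\<close>)
qed

lemma contraction_primes:
  assumes j: "j < n" and P: "P \<in> primes (Suc j)"
  shows "P \<inter> kspan sc x j \<in> primes j"
proof -
  interpret poisson_ext_prime sc br "kspan sc x j" "x j" "al' j" "de' j" "dotp r (eta j) (chi j)" P
    by (rule ext_prime[OF j P])
  have "a \<in> P \<or> b \<in> P" if "a \<in> kspan sc x j" "b \<in> kspan sc x j" "a * b \<in> P" for a b
    using cancel_P that B_sub_S by blast
  then show ?thesis
    using P j act_kspan[of j]
    by (auto simp: primes_def poisson_prime_in_def zero_P zero_B add_P add_B mult_P mult_B one_P
        br_P br_B B_sub_S)
qed

lemma linear_generator:
  assumes j: "j < n" and P: "P \<in> primes (Suc j)" and ne: "P \<noteq> adjoin (P \<inter> kspan sc x j) (x j)"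
  obtains u c \<beta> where "u \<in> kspan sc x j" "c \<in> kspan sc x j" "u \<notin> P" "u * x j + c \<in> P"
    "al' j u = sc \<beta> * u" "al' j c = sc (\<beta> + dotp r (eta j) (chi j)) * c"
proof -
  interpret poisson_ext_prime sc br "kspan sc x j" "x j" "al' j" "de' j" "dotp r (eta j) (chi j)" P
    by (rule ext_prime[OF j P])
  obtain d where lead: "has_lead d"
    using has_lead_or_adjoin[OF ne] .
  show thesis
  proof (rule linear_element[OF _ lead], goal_cases)
    case (1 d b)
    from homogeneous_lead[OF j P 1] show ?case .
  next
    case (2 u c \<beta>)
    then show ?case by (rule that)
  qed
qed

text \<open>The linear element of \<open>P\<close> is carried into \<open>P'\<close> by
  \<open>linear_unique\<close>. Division by it then reduces membership to the common
  contraction.\<close>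

lemma fibre_subset:
  assumes j: "j < n" and P: "P \<in> primes (Suc j)" and P': "P' \<in> primes (Suc j)"
    and eq: "P \<inter> kspan sc x j = P' \<inter> kspan sc x j"
    and ne: "P \<noteq> adjoin (P \<inter> kspan sc x j) (x j)" "P' \<noteq> adjoin (P' \<inter> kspan sc x j) (x j)"
  shows "P \<subseteq> P'"
proof -
  let ?s = "dotp r (eta j) (chi j)"
  interpret p: poisson_ext_prime sc br "kspan sc x j" "x j" "al' j" "de' j" ?s P
    by (rule ext_prime[OF j P])
  interpret q: poisson_ext_prime sc br "kspan sc x j" "x j" "al' j" "de' j" ?s P'
    by (rule ext_prime[OF j P'])
  obtain u c \<beta> where u: "u \<in> kspan sc x j" "c \<in> kspan sc x j" "u \<notin> P" "u * x j + c \<in> P"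
      "al' j u = sc \<beta> * u" "al' j c = sc (\<beta> + ?s) * c"
    using linear_generator[OF j P ne(1)] .
  obtain u' c' \<beta>' where u': "u' \<in> kspan sc x j" "c' \<in> kspan sc x j" "u' \<notin> P'" "u' * x j + c' \<in> P'"
      "al' j u' = sc \<beta>' * u'" "al' j c' = sc (\<beta>' + ?s) * c'"
    using linear_generator[OF j P' ne(2)] .
  have uP': "u \<notin> P'" using u eq by blast
  have "u * br c a - c * br u a - u * c * al' j a + u * u * de' j a \<in> P'" if a: "a \<in> kspan sc x j" for a
  proof -
    \<comment> \<open>The relation lies in the base ring, so equality of contractions moves it from
      \<open>P\<close> to \<open>P'\<close>.\<close>
    have "u * br c a - c * br u a - u * c * al' j a + u * u * de' j a \<in> P \<inter> kspan sc x j"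
      by (intro IntI p.linear_bracket a u p.add_B p.diff_B p.mult_B p.br_B p.al_B p.de_B)
    then show ?thesis using eq by blast
  qed
  from q.linear_unique[OF u'(1,2) u(1,2) u'(3) uP' u'(5,6) u(5,6) u'(4) q.linear_bracket[OF u'(1,2) _ u'(4)] this]
  have z: "u * x j + c \<in> P'" by blast
  show ?thesis
  proof
    fix a assume a: "a \<in> P"
    \<comment> \<open>The remainder \<open>w\<close> lies in \<open>P\<close> and in the base ring,
      hence in \<open>P'\<close>; the power of \<open>u\<close> is cancelled afterwards.\<close>
    obtain N v w where v: "v \<in> p.S" "w \<in> kspan sc x j" "u ^ N * a = (u * x j + c) * v + w"
      using p.reduce_mod_linear[OF u(1,2) p.P_S[OF a]] by blast
    have "w = u ^ N * a - (u * x j + c) * v" using v(3) by simp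
    also have "\<dots> \<in> P"
      by (intro p.diff_P p.mult_P p.mult_P' a u v p.power_S p.B_sub_S)
    finally have "w \<in> P'" using v(2) eq by blast
    then have uN: "u ^ N * a \<in> P'"
      unfolding v(3) by (intro q.add_P q.mult_P' z v)
    have "u ^ N * a \<in> P' \<Longrightarrow> a \<in> P'" for N
    proof (induction N)
      case (Suc N)
      have "u ^ N * a \<in> p.S"
        by (intro p.mult_S p.power_S p.B_sub_S u p.P_S a)
      moreover have "u * (u ^ N * a) \<in> P'"
        using Suc.prems by (simp add: mult.assoc)
      ultimately have "u ^ N * a \<in> P'"
        by (rule q.cancel_P[OF p.B_sub_S[OF u(1)] uP'])
      then show ?case by (rule Suc.IH)
    qed simp
    then show "a \<in> P'" using uN by blast
  qed
qed

text \<open>Besides the extension of \<open>Q\<close> there is at most one member, since any two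
  others contain each other. If there is none, the choice is arbitrary, which is harmless for an
  upper bound.\<close>

lemma fibre_card:
  assumes j: "j < n"
  shows "finite {P \<in> primes (Suc j). P \<inter> kspan sc x j = Q} \<and>
    card {P \<in> primes (Suc j). P \<inter> kspan sc x j = Q} \<le> 2" (is "finite ?F \<and> card ?F \<le> 2")
proof -
  have sub: "?F \<subseteq> {adjoin Q (x j), SOME P. P \<in> ?F \<and> P \<noteq> adjoin Q (x j)}"
  proof (intro subsetI)
    fix P assume P: "P \<in> ?F"
    show "P \<in> {adjoin Q (x j), SOME P. P \<in> ?F \<and> P \<noteq> adjoin Q (x j)}"
    proof (cases "P = adjoin Q (x j)")
      case False
      define P' where "P' = (SOME P. P \<in> ?F \<and> P \<noteq> adjoin Q (x j))"
      have P': "P' \<in> ?F \<and> P' \<noteq> adjoin Q (x j)"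
        unfolding P'_def by (rule someI[of _ P]) (use P False in simp)
      have "P = P'"
        by (rule subset_antisym; rule fibre_subset[OF j]) (use P P' False in auto)
      then show ?thesis by (simp add: P'_def)
    qed simp
  qed
  have "finite {p, q} \<and> card {p, q} \<le> 2" for p q :: "'a set"
    by (simp add: card_insert_if)
  then show ?thesis
    using sub by (meson card_mono finite_subset order_trans)
qed

text \<open>At level zero the ring is the field, whose only prime is zero. Each later level is the
  union of the fibres over the primes below.\<close>

lemma primes_card: "j \<le> n \<Longrightarrow> finite (primes j) \<and> card (primes j) \<le> 2 ^ j"
proof (induction j)
  case 0
  have "P = {0}" if "P \<in> primes 0" for P
  proof -
    have P: "P \<subseteq> range sc" "0 \<in> P" "1 \<notin> P" "\<And>c a. a \<in> P \<Longrightarrow> sc c * a \<in> P"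
      using that by (auto simp: primes_def poisson_prime_in_def kspan_0)
    have "c = 0" if "sc c \<in> P" for c
    proof (rule ccontr)
      assume "c \<noteq> 0"
      then show False
        using P(3) P(4)[OF that, of "inverse c"] sc_cancel[of c 1] by simp
    qed
    then show ?thesis using P(1,2) sc_0 by auto
  qed
  then have "primes 0 \<subseteq> {{0}}" by blast
  then show ?case
    using card_mono[of "{{0::'a}}" "primes 0"] finite_subset[of "primes 0"] by simp
next
  case (Suc j)
  then have IH: "finite (primes j)" "card (primes j) \<le> 2 ^ j" and j: "j < n" by auto
  let ?F = "\<lambda>Q. {P \<in> primes (Suc j). P \<inter> kspan sc x j = Q}"
  have un: "primes (Suc j) = (\<Union>Q\<in>primes j. ?F Q)"
    using contraction_primes[OF j] by blast
  have "card (primes (Suc j)) \<le> (\<Sum>Q\<in>primes j. card (?F Q))"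
    by (subst un) (rule card_UN_le[OF IH(1)])
  also have "\<dots> \<le> (\<Sum>Q\<in>primes j. 2)"
    by (intro sum_mono) (use fibre_card[OF j] in blast)
  also have "\<dots> \<le> 2 ^ Suc j" using IH(2) by simp
  finally show ?case
    using un IH(1) fibre_card[OF j] by (metis (no_types, lifting) finite_UN_I)
qed

end

theorem theorem1p7:
  fixes sc :: "'k::field_char_0 \<Rightarrow> 'a::comm_ring_1"
    and br :: "'a \<Rightarrow> 'a \<Rightarrow> 'a"
    and x :: "nat \<Rightarrow> 'a"
    and n r :: nat
    and al de :: "nat \<Rightarrow> 'a \<Rightarrow> 'a"
    and act :: "(nat \<Rightarrow> 'k) \<Rightarrow> 'a \<Rightarrow> 'a"
    and chi :: "nat \<Rightarrow> nat \<Rightarrow> int"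
    and eta :: "nat \<Rightarrow> nat \<Rightarrow> 'k"
  assumes A: "iterated_poisson sc br x n al de"
    and H: "rational_torus_action sc act r"
    and eig: "\<And>j. j < n \<Longrightarrow> x j \<in> eigsp sc act r (chi j)"
    and eta_alpha: "\<And>i j. j < i \<Longrightarrow> i < n \<Longrightarrow> sc (dotp r (eta i) (chi j)) * x j = al i (x j)"
    and eta_nz: "\<And>i. i < n \<Longrightarrow> dotp r (eta i) (chi i) \<noteq> 0"
  shows "finite {I. H_stable act r I \<and> is_poisson_prime br I}
       \<and> card {I. H_stable act r I \<and> is_poisson_prime br I} \<le> 2 ^ n"
proof -
  \<comment> \<open>Truncating at \<open>r\<close> changes neither \<open>char_val\<close> nor
    \<open>dotp\<close> and yields the normalised weights of the locale.\<close>
  define chi' where "chi' j i = (if i < r then chi j i else 0)" for j i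
  have char_val: "char_val r h (chi' j) = char_val r h (chi j)" for h :: "nat \<Rightarrow> 'k" and j
    by (simp add: char_val_def chi'_def)
  have dotp: "dotp r e (chi' j) = dotp r e (chi j)" for e :: "nat \<Rightarrow> 'k" and j
    by (simp add: dotp_def chi'_def)
  have supp: "chi' j i = 0" if "r \<le> i" for i j
    using that by (simp add: chi'_def)
  interpret poisson_torus sc br x n r al de act chi' eta
    by unfold_locales (use A H eig eta_alpha eta_nz in
      \<open>auto simp: iterated_poisson_def poly_alg_def eigsp_def char_val dotp supp\<close>)
  have "kspan sc x n = UNIV"
    using A by (simp add: iterated_poisson_def poly_alg_def)
  then have "{I. H_stable act r I \<and> is_poisson_prime br I} \<subseteq> primes n"
    by (auto simp: primes_def H_stable_def is_poisson_prime_def is_prime_ideal_def is_ideal_def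
        is_poisson_ideal_def poisson_prime_in_def)
  then show ?thesis
    using primes_card[of n] by (meson card_mono finite_subset order_refl order_trans)
qed

end
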